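(* Let $(\mathcal M,X)$ be an irreducible concurrent system equipped with a Markov measure $\nu=(\nu_\alpha)_{\alpha\in X}$, and let $f_\alpha(x)=\nu_\alpha({\uparrow}x)$ be the associated probabilistic valuation. Then for each $\alpha\in X$, the probability measure $\nu_\alpha$ is the weak limit, as $s\to1^-$, of the probability measures $(\nu_{\alpha,s})_{0\leqslant s<1}$ on $\overline{\mathcal M}$ defined by $$\nu_{\alpha,s}=\frac1{G_\alpha(s)}\sum_{x\in\mathcal M_\alpha}f_\alpha(x)s^{|x|}\delta_{\{x\}},\qquad G_\alpha(s)=\sum_{x\in\mathcal M_\alpha}f_\alpha(x)s^{|x|}.$$
   Context: Trace monoids. Let $\Sigma$ be a finite set and $I\subseteq\Sigma\times\Sigma$ irreflexive and symmetric. The trace monoid $\mathcal M=\mathcal M(\Sigma,I)$ is presented by $\langle\Sigma\mid ab=ba\text{ for }(a,b)\in I\rangle$. Its elements are traces, $\varepsilon$ is the unit, $|x|$ is the length of $x$, and $x\leqslant y$ means $y=xz$ for some $z\in\mathcal M$. $\mathcal M$ is irreducible if the graph $(\Sigma,(\Sigma\times\Sigma)\setminus I)$ is connected. A clique is a trace $a_1\cdots a_k$ of letters with $(a_i,a_j)\in I$ for $i\neq j$ (empty trace included); $\mathcal C$ is the finite set of cliques, identified with subsets of $\Sigma$. For cliques write $c\to d$ if for every letter $b\in d$ there is a letter $a\in c$ with $(a,b)\notin I$. Every trace $x$ has a unique normal form $x=c_1\cdots c_n$ with non-empty cliques $c_i\to c_{i+1}$; put $c_i=\varepsilon$ for $i>n$.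 Generalized traces. $\overline{\mathcal M}$ is the set of sequences $\xi=(c_i)_{i\geqslant1}$ of cliques with $c_i\to c_{i+1}$ for all $i$, a closed (hence compact metrizable) subset of $\mathcal C^{\mathbb N}$; write $C_i(\xi)=c_i$. A trace is identified with its normal form completed by $\varepsilon$'s, so $\mathcal M\subseteq\overline{\mathcal M}$; $\partial\mathcal M=\overline{\mathcal M}\setminus\mathcal M$ is the set of infinite traces. For $x\in\mathcal M$ and $\omega\in\partial\mathcal M$, $x\leqslant\omega$ means $x\leqslant C_1(\omega)\cdots C_n(\omega)$ for some $n$, and ${\uparrow}x=\{\omega\in\partial\mathcal M:x\leqslant\omega\}$. Measures on $\partial\mathcal M$ are regarded as measures on $\overline{\mathcal M}$. Concurrent systems. A concurrent system is a pair $(\mathcal M,X)$, $X$ a finite set of states, with a right monoid action of $\mathcal M$ on $X\sqcup\{\bot\}$, where $\bot\cdot x=\bot$ for all $x$. Put $\mathcal M_\alpha=\{x:\alpha\cdot x\neq\bot\}$, $\mathcal M_{\alpha,\beta}=\{x:\alpha\cdot x=\beta\}$, and $\partial\mathcal M_\alpha=\{\omega\in\partial\mathcal M: x\in\mathcal M_\alpha\text{ for all }x\in\mathcal M\text{ with }x\leqslant\omega\}$. Non-trivial: $\alpha\cdot a\neq\bot$ for some $\alpha\in X$, $a\in\Sigma$. Transitive: $\mathcal M_{\alpha,\beta}\neq\emptyset$ for all $\alpha,\beta\in X$. Irreducible: (1) transitive and non-trivial; (2) $\mathcal M$ is irreducible; (3) for all $\alpha\in X$, $a\in\Sigma$ there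 is $u\in\mathcal M$ with $\alpha\cdot(ua)\neq\bot$. Markov measures. A Markov measure is a family $\nu=(\nu_\alpha)_{\alpha\in X}$ of probability measures on $\partial\mathcal M$ with $\nu_\alpha(\partial\mathcal M_\alpha)=1$, $x\in\mathcal M_\alpha\iff\nu_\alpha({\uparrow}x)>0$, and $\nu_\alpha({\uparrow}(xy))=\nu_\alpha({\uparrow}x)\,\nu_{\alpha\cdot x}({\uparrow}y)$ for all $\alpha,x,y$ (right-hand side $0$ if $\alpha\cdot x=\bot$). For an irreducible system with such $f$, the series $G_\alpha$ have radius of convergence $1$. *)

theory Defs
  imports "HOL-Probability.Probability" "HOL-Algebra.Group"
begin

text \<open>
  The alphabet \<open>\<Sigma>\<close> is a finite type \<^typ>\<open>'a\<close> and the set \<open>X\<close> of states a finite type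
  \<^typ>\<open>'s\<close>. Traces are congruence classes of words over \<^typ>\<open>'a\<close>.
\<close>

section \<open>Trace monoids\<close>

inductive_set trace_cong :: "('a \<times> 'a) set \<Rightarrow> ('a list \<times> 'a list) set"
  for I :: "('a \<times> 'a) set" where
  swap: "(a, b) \<in> I \<Longrightarrow> (u @ [a, b] @ v, u @ [b, a] @ v) \<in> trace_cong I"
| refl: "(u, u) \<in> trace_cong I"
| sym: "(u, v) \<in> trace_cong I \<Longrightarrow> (v, u) \<in> trace_cong I"
| trans: "(u, v) \<in> trace_cong I \<Longrightarrow> (v, w) \<in> trace_cong I \<Longrightarrow> (u, w) \<in> trace_cong I"

definition trace_class :: "('a \<times> 'a) set \<Rightarrow> 'a list \<Rightarrow> 'a list set" where
  "trace_class I w = trace_cong I `` {w}"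

definition trace_monoid :: "('a \<times> 'a) set \<Rightarrow> 'a list set monoid" where
  "trace_monoid I =
    \<lparr>carrier = UNIV // trace_cong I,
     mult = (\<lambda>x y. \<Union>u\<in>x. \<Union>v\<in>y. trace_class I (u @ v)),
     one = trace_class I []\<rparr>"

text \<open>All words in a trace have the same length, see \<open>trace_length_class\<close> below.\<close>
definition trace_length :: "'a list set \<Rightarrow> nat" where
  "trace_length x = length (SOME w. w \<in> x)"

definition trace_le :: "('a \<times> 'a) set \<Rightarrow> 'a list set \<Rightarrow> 'a list set \<Rightarrow> bool" where
  "trace_le I x y \<longleftrightarrow> (\<exists>z\<in>carrier (trace_monoid I). y = x \<otimes>\<^bsub>trace_monoid I\<^esub> z)"

definition irreducible_monoid :: "('a \<times> 'a) set \<Rightarrow> bool" where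
  "irreducible_monoid I \<longleftrightarrow> (\<forall>a b. (a, b) \<in> (- I)\<^sup>*)"

lemma equiv_trace_cong: "equiv UNIV (trace_cong I)"
proof (rule equivI)
  show "refl (trace_cong I)" by (rule refl_onI) (rule trace_cong.refl)
  show "sym (trace_cong I)" by (rule symI) (rule trace_cong.sym)
  show "trans (trace_cong I)" by (rule transI) (rule trace_cong.trans)
qed simp

lemma trace_class_eq_iff: "trace_class I u = trace_class I v \<longleftrightarrow> (u, v) \<in> trace_cong I"
  unfolding trace_class_def using eq_equiv_class_iff[OF equiv_trace_cong] by blast

lemma trace_class_self: "w \<in> trace_class I w"
  by (simp add: trace_class_def trace_cong.refl)

lemma carrier_trace_monoid: "carrier (trace_monoid I) = range (trace_class I)"
  by (auto simp: trace_monoid_def quotient_def trace_class_def)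

lemma trace_cong_append_left: "(u, v) \<in> trace_cong I \<Longrightarrow> (w @ u, w @ v) \<in> trace_cong I"
proof (induction rule: trace_cong.induct)
  case (swap a b u v)
  then show ?case using trace_cong.swap[of a b I "w @ u" v] by simp
qed (auto intro: trace_cong.intros)

lemma trace_cong_append_right: "(u, v) \<in> trace_cong I \<Longrightarrow> (u @ w, v @ w) \<in> trace_cong I"
proof (induction rule: trace_cong.induct)
  case (swap a b u v)
  then show ?case using trace_cong.swap[of a b I u "v @ w"] by simp
qed (auto intro: trace_cong.intros)

lemma trace_cong_append:
  "(u, u') \<in> trace_cong I \<Longrightarrow> (v, v') \<in> trace_cong I \<Longrightarrow> (u @ v, u' @ v') \<in> trace_cong I"
  by (meson trace_cong.trans trace_cong_append_left trace_cong_append_right)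

lemma trace_class_mult:
  "trace_class I u \<otimes>\<^bsub>trace_monoid I\<^esub> trace_class I v = trace_class I (u @ v)"
proof -
  have "trace_class I (u' @ v') = trace_class I (u @ v)"
    if "u' \<in> trace_class I u" "v' \<in> trace_class I v" for u' v'
  proof -
    have "(u @ v, u' @ v') \<in> trace_cong I"
      using that by (intro trace_cong_append) (simp_all add: trace_class_def)
    then show ?thesis
      unfolding trace_class_eq_iff by (rule trace_cong.sym)
  qed
  then have "(\<Union>u'\<in>trace_class I u. \<Union>v'\<in>trace_class I v. trace_class I (u' @ v')) =
      (\<Union>u'\<in>trace_class I u. \<Union>v'\<in>trace_class I v. trace_class I (u @ v))"
    by simp
  also have "\<dots> = trace_class I (u @ v)"
    using trace_class_self[of u I] trace_class_self[of v I] by blast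
  finally show ?thesis
    by (simp add: trace_monoid_def)
qed

lemma monoid_trace_monoid: "monoid (trace_monoid I)"
proof -
  have one: "\<one>\<^bsub>trace_monoid I\<^esub> = trace_class I []"
    by (simp add: trace_monoid_def)
  show ?thesis
    by (rule monoidI) (auto simp: carrier_trace_monoid one trace_class_mult)
qed

lemma trace_length_class: "trace_length (trace_class I w) = length w"
proof -
  have len: "length u = length v" if "(u, v) \<in> trace_cong I" for u v
    using that by induction auto
  have "(SOME u. u \<in> trace_class I w) \<in> trace_class I w"
    by (rule someI) (rule trace_class_self)
  then show ?thesis
    using len by (auto simp: trace_length_def trace_class_def)
qed

section \<open>Cliques and generalized traces\<close>

definition clique :: "('a \<times> 'a) set \<Rightarrow> 'a set \<Rightarrow> bool" where
  "clique I c \<longleftrightarrow> (\<forall>a\<in>c. \<forall>b\<in>c. a \<noteq> b \<longrightarrow> (a, b) \<in> I)"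

text \<open>
  The trace of a clique does not depend on the chosen enumeration, see
  \<open>clique_trace_eq\<close> below.
\<close>
definition clique_trace :: "('a::finite \<times> 'a) set \<Rightarrow> 'a set \<Rightarrow> 'a list set" where
  "clique_trace I c = trace_class I (SOME w. distinct w \<and> set w = c)"

definition clique_arrow :: "('a \<times> 'a) set \<Rightarrow> 'a set \<Rightarrow> 'a set \<Rightarrow> bool" where
  "clique_arrow I c d \<longleftrightarrow> (\<forall>b\<in>d. \<exists>a\<in>c. (a, b) \<notin> I)"

text \<open>Sequences of cliques are indexed from \<open>0\<close>: \<open>\<xi> i\<close> is \<open>C\<^bsub>i+1\<^esub>(\<xi>)\<close>.\<close>
definition gen_traces :: "('a \<times> 'a) set \<Rightarrow> (nat \<Rightarrow> 'a set) set" where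
  "gen_traces I = {\<xi>. \<forall>i. clique I (\<xi> i) \<and> clique_arrow I (\<xi> i) (\<xi> (Suc i))}"

text \<open>The trace \<open>C\<^sub>1(\<xi>) \<cdots> C\<^sub>n(\<xi>)\<close>.\<close>
definition head_trace :: "('a::finite \<times> 'a) set \<Rightarrow> (nat \<Rightarrow> 'a set) \<Rightarrow> nat \<Rightarrow> 'a list set" where
  "head_trace I \<xi> n =
    foldr (mult (trace_monoid I)) (map (\<lambda>i. clique_trace I (\<xi> i)) [0..<n]) \<one>\<^bsub>trace_monoid I\<^esub>"

text \<open>The normal form of a trace, completed by empty cliques.\<close>
definition normal_form :: "('a::finite \<times> 'a) set \<Rightarrow> 'a list set \<Rightarrow> nat \<Rightarrow> 'a set" where
  "normal_form I x = (THE \<xi>. \<xi> \<in> gen_traces I \<and>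
    (\<exists>n. (\<forall>i<n. \<xi> i \<noteq> {}) \<and> (\<forall>i\<ge>n. \<xi> i = {}) \<and> x = head_trace I \<xi> n))"

definition infinite_traces :: "('a::finite \<times> 'a) set \<Rightarrow> (nat \<Rightarrow> 'a set) set" where
  "infinite_traces I = gen_traces I - normal_form I ` carrier (trace_monoid I)"

definition trace_le_inf :: "('a::finite \<times> 'a) set \<Rightarrow> 'a list set \<Rightarrow> (nat \<Rightarrow> 'a set) \<Rightarrow> bool" where
  "trace_le_inf I x \<omega> \<longleftrightarrow> (\<exists>n. trace_le I x (head_trace I \<omega> n))"

definition up :: "('a::finite \<times> 'a) set \<Rightarrow> 'a list set \<Rightarrow> (nat \<Rightarrow> 'a set) set" where
  "up I x = {\<omega> \<in> infinite_traces I. trace_le_inf I x \<omega>}"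

lemma clique_trace_eq:
  assumes "clique I c" "distinct w" "set w = c"
  shows "clique_trace I c = trace_class I w"
proof -
  have move: "(u @ [a], a # u) \<in> trace_cong I" if "\<forall>b\<in>set u. (b, a) \<in> I" for u and a :: 'a
    using that
  proof (induction u)
    case Nil
    show ?case by (simp add: trace_cong.refl)
  next
    case (Cons b u)
    have "(b # u @ [a], b # a # u) \<in> trace_cong I"
      using trace_cong_append_left[of "u @ [a]" "a # u" I "[b]"] Cons by simp
    moreover have "(b # a # u, a # b # u) \<in> trace_cong I"
      using trace_cong.swap[of b a I "[]" u] Cons by simp
    ultimately show ?case by (auto intro: trace_cong.trans)
  qed
  have perm: "(v, w) \<in> trace_cong I"
    if "clique I (set w)" "distinct w" "distinct v" "set v = set w" for v w
    using that
  proof (induction w arbitrary: v)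
    case Nil
    then show ?case by (simp add: trace_cong.refl)
  next
    case (Cons a w)
    then obtain p q where v: "v = p @ a # q"
      by (metis list.set_intros(1) split_list)
    have pq: "distinct (p @ q)" "a \<notin> set (p @ q)" "set (p @ q) = set w"
      using Cons.prems by (auto simp: v)
    then have "(p @ q, w) \<in> trace_cong I"
      using Cons by (intro Cons.IH) (auto simp: clique_def)
    then have "(a # p @ q, a # w) \<in> trace_cong I"
      using trace_cong_append_left[of "p @ q" w I "[a]"] by simp
    moreover have "\<forall>b\<in>set p. (b, a) \<in> I"
      using Cons.prems(1) pq by (auto simp: clique_def)
    then have "(p @ a # q, a # p @ q) \<in> trace_cong I"
      using trace_cong_append_right[OF move[of p a], of q] by simp
    ultimately show ?case by (auto simp: v intro: trace_cong.trans)
  qed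
  have "distinct (SOME w. distinct w \<and> set w = c) \<and> set (SOME w. distinct w \<and> set w = c) = c"
    using assms(2,3) by (intro someI[of "\<lambda>w. distinct w \<and> set w = c" w]) auto
  then show ?thesis
    using perm[of w "SOME w. distinct w \<and> set w = c"] assms
    by (simp add: clique_trace_def trace_class_eq_iff trace_cong.sym)
qed

section \<open>Topology and measures\<close>

definition gen_trace_topology :: "('a \<times> 'a) set \<Rightarrow> (nat \<Rightarrow> 'a set) topology" where
  "gen_trace_topology I =
    subtopology (product_topology (\<lambda>_. discrete_topology {c. clique I c}) UNIV) (gen_traces I)"

definition borel_of :: "'b topology \<Rightarrow> 'b measure" where
  "borel_of T = sigma (topspace T) {U. openin T U}"

text \<open>
  Weak convergence of measures on \<open>borel_of T\<close>. The library's \<^const>\<open>weak_conv_m\<close> only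
  covers sequences of distributions on the real line.
\<close>
definition weak_limit ::
    "'b topology \<Rightarrow> ('c \<Rightarrow> 'b measure) \<Rightarrow> 'b measure \<Rightarrow> 'c filter \<Rightarrow> bool" where
  "weak_limit T \<mu> \<mu>' F \<longleftrightarrow>
    (\<forall>g. continuous_map T euclideanreal g \<and> bounded (g ` topspace T) \<longrightarrow>
      ((\<lambda>s. integral\<^sup>L (\<mu> s) g) \<longlongrightarrow> integral\<^sup>L \<mu>' g) F)"

section \<open>Concurrent systems\<close>

text \<open>The sink \<open>\<bottom>\<close> is \<^const>\<open>None\<close>.\<close>
definition concurrent_system ::
    "('a::finite \<times> 'a) set \<Rightarrow> ('s::finite option \<Rightarrow> 'a list set \<Rightarrow> 's option) \<Rightarrow> bool" where
  "concurrent_system I act \<longleftrightarrow>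
    irrefl I \<and> sym I \<and>
    (\<forall>p. act p \<one>\<^bsub>trace_monoid I\<^esub> = p) \<and>
    (\<forall>p. \<forall>x\<in>carrier (trace_monoid I). \<forall>y\<in>carrier (trace_monoid I).
      act p (x \<otimes>\<^bsub>trace_monoid I\<^esub> y) = act (act p x) y) \<and>
    (\<forall>x\<in>carrier (trace_monoid I). act None x = None)"

definition traces_from ::
    "('a::finite \<times> 'a) set \<Rightarrow> ('s option \<Rightarrow> 'a list set \<Rightarrow> 's option) \<Rightarrow> 's \<Rightarrow> 'a list set set" where
  "traces_from I act \<alpha> = {x \<in> carrier (trace_monoid I). act (Some \<alpha>) x \<noteq> None}"

definition traces_between ::
    "('a::finite \<times> 'a) set \<Rightarrow> ('s option \<Rightarrow> 'a list set \<Rightarrow> 's option) \<Rightarrow> 's \<Rightarrow> 's \<Rightarrow> 'a list set set"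
  where
  "traces_between I act \<alpha> \<beta> = {x \<in> carrier (trace_monoid I). act (Some \<alpha>) x = Some \<beta>}"

definition infinite_traces_from ::
    "('a::finite \<times> 'a) set \<Rightarrow> ('s option \<Rightarrow> 'a list set \<Rightarrow> 's option) \<Rightarrow> 's \<Rightarrow> (nat \<Rightarrow> 'a set) set"
  where
  "infinite_traces_from I act \<alpha> =
    {\<omega> \<in> infinite_traces I.
      \<forall>x\<in>carrier (trace_monoid I). trace_le_inf I x \<omega> \<longrightarrow> x \<in> traces_from I act \<alpha>}"

definition nontrivial_system ::
    "('a::finite \<times> 'a) set \<Rightarrow> ('s option \<Rightarrow> 'a list set \<Rightarrow> 's option) \<Rightarrow> bool" where
  "nontrivial_system I act \<longleftrightarrow> (\<exists>\<alpha> a. act (Some \<alpha>) (trace_class I [a]) \<noteq> None)"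

definition transitive_system ::
    "('a::finite \<times> 'a) set \<Rightarrow> ('s option \<Rightarrow> 'a list set \<Rightarrow> 's option) \<Rightarrow> bool" where
  "transitive_system I act \<longleftrightarrow> (\<forall>\<alpha> \<beta>. traces_between I act \<alpha> \<beta> \<noteq> {})"

definition irreducible_system ::
    "('a::finite \<times> 'a) set \<Rightarrow> ('s option \<Rightarrow> 'a list set \<Rightarrow> 's option) \<Rightarrow> bool" where
  "irreducible_system I act \<longleftrightarrow>
    transitive_system I act \<and> nontrivial_system I act \<and>
    irreducible_monoid I \<and>
    (\<forall>\<alpha> a. \<exists>u\<in>carrier (trace_monoid I).
      act (Some \<alpha>) (u \<otimes>\<^bsub>trace_monoid I\<^esub> trace_class I [a]) \<noteq> None)"

section \<open>Markov measures\<close>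

definition markov_measure ::
    "('a::finite \<times> 'a) set \<Rightarrow> ('s::finite option \<Rightarrow> 'a list set \<Rightarrow> 's option) \<Rightarrow>
      ('s \<Rightarrow> (nat \<Rightarrow> 'a set) measure) \<Rightarrow> bool" where
  "markov_measure I act \<nu> \<longleftrightarrow>
    (\<forall>\<alpha>. prob_space (\<nu> \<alpha>) \<and>
      sets (\<nu> \<alpha>) = sets (borel_of (subtopology (gen_trace_topology I) (infinite_traces I))) \<and>
      measure (\<nu> \<alpha>) (infinite_traces_from I act \<alpha>) = 1) \<and>
    (\<forall>\<alpha>. \<forall>x\<in>carrier (trace_monoid I).
      x \<in> traces_from I act \<alpha> \<longleftrightarrow> measure (\<nu> \<alpha>) (up I x) > 0) \<and>
    (\<forall>\<alpha>. \<forall>x\<in>carrier (trace_monoid I). \<forall>y\<in>carrier (trace_monoid I).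
      measure (\<nu> \<alpha>) (up I (x \<otimes>\<^bsub>trace_monoid I\<^esub> y)) =
        measure (\<nu> \<alpha>) (up I x) *
          (case act (Some \<alpha>) x of None \<Rightarrow> 0 | Some \<beta> \<Rightarrow> measure (\<nu> \<beta>) (up I y)))"

definition valuation ::
    "('a::finite \<times> 'a) set \<Rightarrow> ('s \<Rightarrow> (nat \<Rightarrow> 'a set) measure) \<Rightarrow> 's \<Rightarrow> 'a list set \<Rightarrow> real" where
  "valuation I \<nu> \<alpha> x = measure (\<nu> \<alpha>) (up I x)"

text \<open>A measure on \<open>\<partial>\<M>\<close> regarded as a measure on the space of generalized traces.\<close>
definition extend_measure_gen ::
    "('a \<times> 'a) set \<Rightarrow> (nat \<Rightarrow> 'a set) measure \<Rightarrow> (nat \<Rightarrow> 'a set) measure" where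
  "extend_measure_gen I \<mu> = distr \<mu> (borel_of (gen_trace_topology I)) (\<lambda>\<omega>. \<omega>)"

definition gen_series ::
    "('a::finite \<times> 'a) set \<Rightarrow> ('s option \<Rightarrow> 'a list set \<Rightarrow> 's option) \<Rightarrow>
      ('s \<Rightarrow> 'a list set \<Rightarrow> real) \<Rightarrow> 's \<Rightarrow> real \<Rightarrow> real" where
  "gen_series I act f \<alpha> s = (\<Sum>\<^sub>\<infinity>x\<in>traces_from I act \<alpha>. f \<alpha> x * s ^ trace_length x)"

text \<open>
  The discrete measure \<open>\<nu>\<^bsub>\<alpha>,s\<^esub>\<close>: the Dirac mass at a trace \<open>x\<close> sits at its normal form.
  If the series diverged, \<^const>\<open>infsum\<close> would be \<open>0\<close> and the measure null, hence not a
  probability measure.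
\<close>
definition boltzmann_measure ::
    "('a::finite \<times> 'a) set \<Rightarrow> ('s option \<Rightarrow> 'a list set \<Rightarrow> 's option) \<Rightarrow>
      ('s \<Rightarrow> 'a list set \<Rightarrow> real) \<Rightarrow> 's \<Rightarrow> real \<Rightarrow> (nat \<Rightarrow> 'a set) measure" where
  "boltzmann_measure I act f \<alpha> s =
    distr
      (point_measure (traces_from I act \<alpha>)
        (\<lambda>x. ennreal (f \<alpha> x * s ^ trace_length x / gen_series I act f \<alpha> s)))
      (borel_of (gen_trace_topology I)) (normal_form I)"

end

theory Submission
  imports Defs "HOL-Library.Sublist"
begin

text \<open>
  For a trace \<open>x\<close> leading from \<open>\<alpha>\<close> to \<open>\<beta>\<close>, the chain rule gives the cone of all generalized traces
  above \<open>x\<close> the mass \<open>f\<^sub>\<alpha>(x) s\<^bsup>|x|\<^esup> G\<^sub>\<beta>(s) / G\<^sub>\<alpha>(s)\<close> under \<open>\<nu>\<^bsub>\<alpha>,s\<^esub>\<close>, while its mass under \<open>\<nu>\<^sub>\<alpha>\<close> is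
  \<open>f\<^sub>\<alpha>(x)\<close>. Cones determine the finitely many cylinders of each depth, by a triangular system
  (\<open>measure_cylinder_tendsto\<close>), and by compactness cylinders determine weak convergence
  (\<open>weak_limit_if_cones_converge\<close>). So everything rests on \<open>G\<^sub>\<beta>(s) / G\<^sub>\<alpha>(s) \<rightarrow> 1\<close> as
  \<open>s \<rightarrow> 1\<close>, which is \<open>avoiding_series_quotient_tendsto\<close>.

  This is proved by a maximum principle. For a set \<open>A\<close> of letters consider the generating series
  of the traces that avoid \<open>A\<close>, divided by \<open>\<Sum>\<^sub>\<beta> G\<^sub>\<beta>(s)\<close>. A trace that avoids \<open>A\<close> and contains a
  letter \<open>b \<notin> A\<close> factors through the part below its first \<open>b\<close>. Two such parts that lie below the
  same infinite trace are equal (\<open>first_ideal_unique\<close>), hence their cones are disjoint and their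
  valuations are the transition probabilities of a sub-Markov chain on the states
  (\<open>sum_first_prob_le\<close>, \<open>avoiding_series_recurrence\<close>). By descending induction on \<open>A\<close> the traces that
  avoid \<open>A\<close> and one more letter are negligible as \<open>s \<rightarrow> 1\<close>; in the limit the recurrence then says
  that the vector of ratios for \<open>A\<close> is subharmonic for the chain of every \<open>b \<notin> A\<close>. At a state
  where it is maximal and positive, no mass may be lost and the maximum propagates
  (\<open>subharmonic_maximum\<close>). For nonempty \<open>A\<close> this contradicts irreducibility, so the limit is zero
  (\<open>subharmonic_zero\<close>); the induction starts with all letters, where only the empty trace is left
  and \<open>G\<^sub>\<alpha>(s) \<ge> 1 / (1 - s)\<close>. For empty \<open>A\<close> the maximum propagates to all states
  (\<open>subharmonic_const\<close>), so all the \<open>G\<^sub>\<beta>\<close> are asymptotically equal.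

  The combinatorics of traces is read off from projections: two words represent the same trace if
  and only if their projections onto all pairs of dependent letters agree (\<open>cong_iff_proj\<close>). This
  makes trace prefixes a matter of word prefixes, and yields cancellation, meets of prefixes,
  and the normal form.
\<close>

section \<open>Projections and the prefix order\<close>

definition proj :: "'a \<Rightarrow> 'a \<Rightarrow> 'a list \<Rightarrow> 'a list" where
  "proj a b w = filter (\<lambda>c. c = a \<or> c = b) w"

lemma proj_append [simp]: "proj a b (u @ v) = proj a b u @ proj a b v"
  by (simp add: proj_def)

lemma proj_Nil [simp]: "proj a b [] = []"
  by (simp add: proj_def)

lemma proj_Cons: "proj a b (c # w) = (if c = a \<or> c = b then c # proj a b w else proj a b w)"
  by (simp add: proj_def)

lemma set_proj: "set (proj a b w) = set w \<inter> {a, b}"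
  by (auto simp: proj_def)

lemma proj_eq_Nil: "proj a b w = [] \<longleftrightarrow> a \<notin> set w \<and> b \<notin> set w"
  by (auto simp: proj_def filter_empty_conv)

lemma proj_commute: "proj a b w = proj b a w"
  by (simp add: proj_def disj_commute)

lemma count_proj: "c = a \<or> c = b \<Longrightarrow> count_list (proj a b w) c = count_list w c"
  by (induction w) (auto simp: proj_def)

lemma length_proj_self: "length (proj a a w) = count_list w a"
  by (induction w) (auto simp: proj_def)

lemma length_proj: "a \<noteq> b \<Longrightarrow> length (proj a b w) = count_list w a + count_list w b"
  by (induction w) (auto simp: proj_def)

text \<open>
  The prefix order of traces read on words: two letters are comparable in a trace exactly through
  the projections onto pairs of dependent letters, and each projection is an honest word.
\<close>
definition word_le :: "('a \<times> 'a) set \<Rightarrow> 'a list \<Rightarrow> 'a list \<Rightarrow> bool" where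
  "word_le I u v \<longleftrightarrow> (\<forall>a b. (a, b) \<notin> I \<longrightarrow> prefix (proj a b u) (proj a b v))"

lemma word_le_refl [simp]: "word_le I u u"
  by (simp add: word_le_def)

lemma word_le_Nil [simp]: "word_le I [] u"
  by (simp add: word_le_def)

lemma word_le_trans: "word_le I u v \<Longrightarrow> word_le I v w \<Longrightarrow> word_le I u w"
  unfolding word_le_def by (meson prefix_order.trans)

lemma word_le_append [simp]: "word_le I u (u @ v)"
  by (simp add: word_le_def)

lemma word_le_append_cancel [simp]: "word_le I (u @ v) (u @ w) \<longleftrightarrow> word_le I v w"
  by (simp add: word_le_def)

lemma word_le_Cons_cancel [simp]: "word_le I (a # u) (a # v) \<longleftrightarrow> word_le I u v"
  using word_le_append_cancel[of I "[a]" u v] by simp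

locale trace_alphabet =
  fixes I :: "('a::finite \<times> 'a) set"
  assumes irrefl_I: "irrefl I" and sym_I: "sym I"
begin

lemma not_I_refl: "(a, a) \<notin> I"
  using irrefl_I by (auto simp: irrefl_def)

lemma I_symD: "(a, b) \<in> I \<Longrightarrow> (b, a) \<in> I"
  using sym_I by (auto dest: symD)

lemma word_le_count: "word_le I u v \<Longrightarrow> count_list u a \<le> count_list v a"
  unfolding word_le_def by (metis length_proj_self not_I_refl prefix_length_le)

lemma word_le_set: "word_le I u v \<Longrightarrow> set u \<subseteq> set v"
  using word_le_count[of u v] by (metis count_list_0_iff le_zero_eq subsetI)

lemma proj_cong:
  assumes "(u, v) \<in> trace_cong I" "(a, b) \<notin> I"
  shows "proj a b u = proj a b v"
  using assms
proof induction
  case (swap c d u v)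
  then have "(b, a) \<notin> I" using I_symD by blast
  with swap show ?case using not_I_refl by (auto simp: proj_Cons)
qed auto

text \<open>
  All letters standing before the first \<open>a\<close> of \<open>v\<close> commute with \<open>a\<close>: a dependent one would come
  first in its projection with \<open>a\<close>.
\<close>
lemma minimal_letter_to_front:
  assumes "word_le I [a] v"
  obtains v' where "(v, a # v') \<in> trace_cong I"
proof -
  have "a \<in> set v" using word_le_set[OF assms] by simp
  then obtain p q where v: "v = p @ a # q" and ap: "a \<notin> set p"
    by (meson split_list_first)
  have pI: "(b, a) \<in> I" if b: "b \<in> set p" for b
  proof (rule ccontr)
    assume "(b, a) \<notin> I"
    then have "prefix (proj b a [a]) (proj b a v)"
      using assms by (simp add: word_le_def)
    then have "prefix [a] (proj b a p @ a # proj b a q)"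
      by (simp add: v proj_Cons)
    moreover have "proj b a p \<noteq> []" "a \<notin> set (proj b a p)"
      using b ap by (auto simp: proj_eq_Nil set_proj)
    ultimately show False by (cases "proj b a p") auto
  qed
  have "(p @ a # q, a # p @ q) \<in> trace_cong I"
    using pI
  proof (induction p)
    case (Cons b p)
    have "(b # p @ a # q, b # a # p @ q) \<in> trace_cong I"
      using trace_cong_append_left[of "p @ a # q" "a # p @ q" I "[b]"] Cons by simp
    moreover have "(b # a # p @ q, a # b # p @ q) \<in> trace_cong I"
      using trace_cong.swap[of b a I "[]" "p @ q"] Cons.prems by simp
    ultimately show ?case by (auto intro: trace_cong.trans)
  qed (simp add: trace_cong.refl)
  then show thesis using that v by blast
qed

lemma word_le_cong:
  "(u, u') \<in> trace_cong I \<Longrightarrow> (v, v') \<in> trace_cong I \<Longrightarrow> word_le I u v \<longleftrightarrow> word_le I u' v'"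
  unfolding word_le_def using proj_cong by metis

text \<open>The letters of \<open>u\<close> are pulled to the front of \<open>v\<close> one after the other.\<close>
lemma word_le_iff_factor: "word_le I u v \<longleftrightarrow> (\<exists>z. (v, u @ z) \<in> trace_cong I)"
proof
  assume "word_le I u v"
  then show "\<exists>z. (v, u @ z) \<in> trace_cong I"
  proof (induction u arbitrary: v)
    case Nil
    then show ?case using trace_cong.refl by force
  next
    case (Cons a u)
    have "word_le I [a] v"
      using Cons.prems word_le_append[of I "[a]" u] word_le_trans by fastforce
    then obtain v' where v': "(v, a # v') \<in> trace_cong I" by (rule minimal_letter_to_front)
    have "word_le I (a # u) (a # v')"
      using Cons.prems word_le_cong[OF trace_cong.refl v'] by blast
    then obtain z where "(v', u @ z) \<in> trace_cong I"
      using Cons.IH by auto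
    then show ?case
      using v' trace_cong_append_left[of v' "u @ z" I "[a]"]
      by (auto intro: trace_cong.trans)
  qed
next
  assume "\<exists>z. (v, u @ z) \<in> trace_cong I"
  then show "word_le I u v"
    using word_le_cong[OF trace_cong.refl] by fastforce
qed

text \<open>
  Equal projections make \<open>u\<close> a prefix of \<open>v\<close>, and the projections onto single letters leave
  nothing for the cofactor. Cancellativity of the trace monoid is a consequence, because words
  are cancellative.
\<close>
lemma cong_iff_proj:
  "(u, v) \<in> trace_cong I \<longleftrightarrow> (\<forall>a b. (a, b) \<notin> I \<longrightarrow> proj a b u = proj a b v)"
proof
  assume *: "\<forall>a b. (a, b) \<notin> I \<longrightarrow> proj a b u = proj a b v"
  then have "word_le I u v" by (simp add: word_le_def)
  then obtain z where z: "(v, u @ z) \<in> trace_cong I" using word_le_iff_factor by blast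
  have "proj a a (u @ z) = proj a a u" for a
    using * proj_cong[OF z] not_I_refl by metis
  then have "a \<notin> set z" for a by (simp add: proj_eq_Nil)
  then have "z = []" by (metis list.set_intros(1) neq_Nil_conv)
  then show "(u, v) \<in> trace_cong I" using z trace_cong.sym by auto
qed (use proj_cong in blast)

lemma cong_cancel_left: "(u @ v, u @ w) \<in> trace_cong I \<Longrightarrow> (v, w) \<in> trace_cong I"
  by (simp add: cong_iff_proj)

lemma word_le_antisym: "word_le I u v \<Longrightarrow> word_le I v u \<Longrightarrow> (u, v) \<in> trace_cong I"
  unfolding cong_iff_proj word_le_def using prefix_order.antisym by blast

lemma cong_count: "(u, v) \<in> trace_cong I \<Longrightarrow> count_list u a = count_list v a"
  by (metis length_proj_self not_I_refl proj_cong)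

lemma cong_set: "(u, v) \<in> trace_cong I \<Longrightarrow> set u = set v"
  using cong_count by (metis count_list_0_iff subsetI subset_antisym)

text \<open>
  Two prefixes of the same trace are compared by their letter counts alone, because each of
  their projections is a prefix of one and the same word.
\<close>
lemma word_le_if_count_le:
  assumes "word_le I x h" "word_le I y h" "\<And>a. count_list x a \<le> count_list y a"
  shows "word_le I x y"
  unfolding word_le_def
proof (intro allI impI)
  fix a b assume ab: "(a, b) \<notin> I"
  have "length (proj a b x) \<le> length (proj a b y)"
    using assms(3)[of a] assms(3)[of b]
    by (cases "a = b") (simp_all add: length_proj length_proj_self)
  then show "prefix (proj a b x) (proj a b y)"
    using assms(1,2) ab unfolding word_le_def by (meson prefix_length_prefix)
qed

lemma cong_if_count_eq:
  assumes "word_le I x h" "word_le I y h" "\<And>a. count_list x a = count_list y a"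
  shows "(x, y) \<in> trace_cong I"
  using assms word_le_if_count_le word_le_antisym by (metis order.refl)

text \<open>
  A letter of \<open>m\<close> that depends on \<open>c\<close> would have to come after \<open>c\<close> in their projection, so
  without \<open>c\<close> itself \<open>m\<close> contains no such letter.
\<close>
lemma word_le_drop_independent:
  assumes "word_le I m (c # x)" "c \<notin> set m"
  shows "word_le I m x"
  unfolding word_le_def
proof (intro allI impI)
  fix a b assume ab: "(a, b) \<notin> I"
  then have *: "prefix (proj a b m) (proj a b (c # x))"
    using assms by (simp add: word_le_def)
  show "prefix (proj a b m) (proj a b x)"
  proof (cases "c = a \<or> c = b")
    case True
    then have "prefix (proj a b m) (c # proj a b x)" using * by (simp add: proj_Cons)
    moreover have "c \<notin> set (proj a b m)" using assms by (simp add: set_proj)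
    ultimately have "proj a b m = []" by (cases "proj a b m") auto
    then show ?thesis by simp
  qed (use * in \<open>simp add: proj_Cons\<close>)
qed

lemma word_le_pull:
  assumes "word_le I x (c # h)" "c \<in> set x"
  obtains x' where "(x, c # x') \<in> trace_cong I" "word_le I x' h"
proof -
  have "word_le I [c] x"
  proof (rule word_le_if_count_le)
    show "word_le I [c] (c # h)" by simp
    show "count_list [c] a \<le> count_list x a" for a
      using assms(2) count_list_0_iff[of x c] by (auto simp del: count_list_0_iff simp: Suc_le_eq intro: gr0I)
  qed fact
  then obtain x' where x': "(x, c # x') \<in> trace_cong I" by (rule minimal_letter_to_front)
  then have "word_le I (c # x') (c # h)"
    using assms(1) word_le_cong[OF x' trace_cong.refl] by blast
  then show thesis using that x' by simp
qed

text \<open>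
  The meet is computed letter by letter: the first letter \<open>c\<close> of \<open>x\<close> is either also a first letter
  of \<open>y\<close>, or it does not occur in \<open>y\<close>; in the latter case nothing that depends on \<open>c\<close> occurs in
  \<open>y\<close> either.
\<close>
lemma word_le_meet:
  assumes "word_le I x h" "word_le I y h"
  shows "\<exists>m. word_le I m x \<and> word_le I m y \<and>
    (\<forall>a. count_list m a = min (count_list x a) (count_list y a))"
  using assms
proof (induction x arbitrary: y h)
  case Nil
  show ?case by (intro exI[of _ "[]"]) simp
next
  case (Cons c x)
  have "word_le I [c] h"
    using Cons.prems(1) word_le_append[of I "[c]" x] word_le_trans by fastforce
  then obtain h' where h': "(h, c # h') \<in> trace_cong I" by (rule minimal_letter_to_front)
  have x: "word_le I x h'" and y: "word_le I y (c # h')"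
    using Cons.prems word_le_cong[OF trace_cong.refl h'] by auto
  show ?case
  proof (cases "c \<in> set y")
    case True
    then obtain y' where y': "(y, c # y') \<in> trace_cong I" "word_le I y' h'"
      using word_le_pull y by blast
    then obtain m where m: "word_le I m x" "word_le I m y'"
      "\<forall>a. count_list m a = min (count_list x a) (count_list y' a)"
      using Cons.IH[OF x] by blast
    have "word_le I (c # m) y"
      using m(2) word_le_cong[OF trace_cong.refl y'(1)] by auto
    then show ?thesis
      using m cong_count[OF y'(1)] by (intro exI[of _ "c # m"]) auto
  next
    case False
    then have "word_le I y h'" using word_le_drop_independent y by blast
    then obtain m where m: "word_le I m x" "word_le I m y"
      "\<forall>a. count_list m a = min (count_list x a) (count_list y a)"
      using Cons.IH[OF x] by blast
    have cm: "c \<notin> set m" using word_le_set[OF m(2)] False by auto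
    have "word_le I m (c # x)"
    proof (rule word_le_if_count_le)
      show "word_le I m h" using m(2) Cons.prems(2) word_le_trans by blast
      show "count_list m a \<le> count_list (c # x) a" for a using m(3) by auto
    qed fact
    moreover have "count_list y c = 0" using False by simp
    ultimately show ?thesis using m by (intro exI[of _ m]) auto
  qed
qed

text \<open>Seen through the projection onto \<open>a\<close> and \<open>b\<close>, \<open>u\<close> begins with \<open>b\<close> and \<open>v\<close> with \<open>a\<close>.\<close>
lemma first_letters_conflict:
  assumes "word_le I u h" "word_le I v h" "(a, b) \<notin> I"
    and "b \<in> set u" "a \<notin> set u" "a \<in> set v" "b \<notin> set v"
  shows False
proof -
  have "prefix (proj a b u) (proj a b h)" "prefix (proj a b v) (proj a b h)"
    using assms by (simp_all add: word_le_def)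
  moreover have "set (proj a b u) = {b}" "set (proj a b v) = {a}"
    using assms by (auto simp: set_proj)
  then obtain xs ys where "proj a b u = b # xs" "proj a b v = a # ys"
    by (metis (no_types) insert_not_empty list.exhaust list.set(1) list.set_intros(1) singletonD)
  ultimately show False using assms by (cases "proj a b h") auto
qed

end

section \<open>Normal forms\<close>

context trace_alphabet begin

definition clique_word :: "'a set \<Rightarrow> 'a list" where
  "clique_word c = (SOME w. distinct w \<and> set w = c)"

lemma clique_word: "distinct (clique_word c)" "set (clique_word c) = c"
proof -
  obtain w :: "'a list" where "set w = c" "distinct w"
    using finite_distinct_list[of c] by auto
  then have "distinct (clique_word c) \<and> set (clique_word c) = c"
    unfolding clique_word_def by (intro someI[of "\<lambda>w. distinct w \<and> set w = c" w]) auto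
  then show "distinct (clique_word c)" "set (clique_word c) = c" by auto
qed

lemma clique_word_empty [simp]: "clique_word {} = []"
  using clique_word(2)[of "{}"] by simp

lemma count_clique_word: "count_list (clique_word c) b = (if b \<in> c then 1 else 0)"
proof -
  have "distinct w \<Longrightarrow> count_list w b = (if b \<in> set w then 1 else 0)" for w :: "'a list"
    by (induction w) auto
  then show ?thesis using clique_word[of c] by simp
qed

lemma clique_no_dependent:
  "clique I c \<Longrightarrow> a \<in> c \<Longrightarrow> b \<in> c \<Longrightarrow> (a, b) \<notin> I \<Longrightarrow> a = b"
  by (auto simp: clique_def)

lemma proj_clique_word:
  assumes "clique I c" "(a, b) \<notin> I" "b \<in> c"
  shows "proj a b (clique_word c) = [b]"
proof -
  have "set (proj a b (clique_word c)) = {b}"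
    using assms clique_no_dependent[OF assms(1), of a b] by (auto simp: set_proj clique_word)
  moreover have "distinct (proj a b (clique_word c))"
    by (simp add: proj_def clique_word)
  ultimately show ?thesis
    by (metis distinct_card card.empty card_insert_disjoint finite.emptyI empty_iff
        length_0_conv length_Suc_conv list.set(1) list.simps(15) singleton_insert_inj_eq)
qed

definition head_word :: "(nat \<Rightarrow> 'a set) \<Rightarrow> nat \<Rightarrow> 'a list" where
  "head_word \<xi> n = concat (map (\<lambda>i. clique_word (\<xi> i)) [0..<n])"

lemma head_word_0 [simp]: "head_word \<xi> 0 = []"
  by (simp add: head_word_def)

lemma head_word_Suc: "head_word \<xi> (Suc n) = head_word \<xi> n @ clique_word (\<xi> n)"
  by (simp add: head_word_def)

lemma head_word_split:
  "n \<le> m \<Longrightarrow> head_word \<xi> m = head_word \<xi> n @ concat (map (\<lambda>i. clique_word (\<xi> i)) [n..<m])"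
  unfolding head_word_def by (metis concat_append le0 le_iff_add map_append upt_add_eq_append)

lemma head_word_mono: "n \<le> m \<Longrightarrow> word_le I (head_word \<xi> n) (head_word \<xi> m)"
  by (simp add: head_word_split)

lemma head_word_cong: "(\<And>i. i < n \<Longrightarrow> \<xi> i = \<xi>' i) \<Longrightarrow> head_word \<xi> n = head_word \<xi>' n"
  unfolding head_word_def by (intro arg_cong[of _ _ concat] map_cong) auto

lemma head_word_case_nat: "head_word (case_nat c \<xi>) (Suc n) = clique_word c @ head_word \<xi> n"
  by (induction n) (simp_all add: head_word_Suc)

lemma head_trace_eq: "head_trace I \<xi> n = trace_class I (head_word \<xi> n)"
proof -
  have "foldr (mult (trace_monoid I)) (map (\<lambda>i. trace_class I (g i)) xs) \<one>\<^bsub>trace_monoid I\<^esub>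
      = trace_class I (concat (map g xs))" for g and xs :: "nat list"
    by (induction xs) (simp_all add: trace_class_mult, simp add: trace_monoid_def)
  then show ?thesis
    by (simp add: head_trace_def head_word_def clique_trace_def clique_word_def)
qed

lemma head_trace_carrier: "head_trace I \<xi> n \<in> carrier (trace_monoid I)"
  by (simp add: head_trace_eq carrier_trace_monoid)

lemma gen_traces_clique: "\<xi> \<in> gen_traces I \<Longrightarrow> clique I (\<xi> i)"
  by (simp add: gen_traces_def)

lemma gen_traces_pred:
  assumes "\<xi> \<in> gen_traces I" "b \<in> \<xi> j" "0 < j"
  obtains a where "a \<in> \<xi> (j - 1)" "(a, b) \<notin> I"
proof -
  have "clique_arrow I (\<xi> (j - 1)) (\<xi> (Suc (j - 1)))"
    using assms(1) by (simp only: gen_traces_def mem_Collect_eq)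
  then show thesis using that assms(2,3) by (auto simp: clique_arrow_def)
qed

text \<open>
  A trace that is the product of \<open>n\<close> successive cliques of a normal form has no chain of more
  than \<open>n\<close> dependent letters, whereas in a generalized trace \<open>\<xi>'\<close> every letter of level \<open>j\<close>
  sits on top of a dependent letter of level \<open>j - 1\<close>. Hence such a trace cannot reach beyond
  level \<open>n\<close> of \<open>\<xi>'\<close>.
\<close>
lemma head_word_le_level:
  assumes g: "\<xi> \<in> gen_traces I" "\<xi>' \<in> gen_traces I"
    and le: "word_le I (head_word \<xi> n) (head_word \<xi>' m)"
  shows "word_le I (head_word \<xi> n) (head_word \<xi>' n)"
  using le
proof (induction n)
  case (Suc n)
  show ?case
  proof (cases "m \<le> Suc n")
    case True
    then show ?thesis using Suc.prems head_word_mono word_le_trans by blast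
  next
    case False
    then have nm: "n \<le> m" "Suc n \<le> m" by auto
    have IH: "word_le I (head_word \<xi> n) (head_word \<xi>' n)"
      using Suc word_le_trans head_word_mono[of n "Suc n" \<xi>] by auto
    show ?thesis
    proof (rule word_le_if_count_le[OF Suc.prems head_word_mono[OF nm(2)]], rule ccontr)
      fix b
      assume "\<not> count_list (head_word \<xi> (Suc n)) b \<le> count_list (head_word \<xi>' (Suc n)) b"
      then have b: "b \<in> \<xi> n" "b \<notin> \<xi>' n"
        "count_list (head_word \<xi>' n) b = count_list (head_word \<xi> n) b"
        using word_le_count[OF IH, of b]
        by (auto simp: head_word_Suc count_clique_word split: if_splits)
      have "count_list (head_word \<xi>' n) b < count_list (head_word \<xi>' m) b"
        using word_le_count[OF Suc.prems, of b] b by (simp add: head_word_Suc count_clique_word)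
      then have "b \<in> set (concat (map (\<lambda>i. clique_word (\<xi>' i)) [n..<m]))"
        using count_notin by (fastforce simp: head_word_split[OF nm(1), of \<xi>'] intro: ccontr)
      then have "\<exists>j. n \<le> j \<and> j < m \<and> b \<in> \<xi>' j"
        by (auto simp: clique_word)
      \<comment> \<open>with the first such level, no \<open>b\<close> is left between the levels \<open>n\<close> and \<open>j\<close> of \<open>\<xi>'\<close>\<close>
      define j where "j = (LEAST j. n \<le> j \<and> j < m \<and> b \<in> \<xi>' j)"
      have j: "n \<le> j" "j < m" "b \<in> \<xi>' j"
        using LeastI_ex[OF \<open>\<exists>j. n \<le> j \<and> j < m \<and> b \<in> \<xi>' j\<close>] unfolding j_def by auto
      have before: "b \<notin> \<xi>' i" if "n \<le> i" "i < j" for i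
        using not_less_Least[of i "\<lambda>j. n \<le> j \<and> j < m \<and> b \<in> \<xi>' j"] that j unfolding j_def by auto
      have "n < j" using j b le_neq_implies_less by blast
      then obtain a where a: "a \<in> \<xi>' (j - 1)" "(a, b) \<notin> I"
        using gen_traces_pred[OF g(2) j(3)] by auto
      have "b \<notin> \<xi>' (j - 1)" using before \<open>n < j\<close> by simp
      then have "a \<noteq> b" using a by auto
      let ?P = "proj a b (head_word \<xi> n)" and ?Q = "proj a b (head_word \<xi>' n)"
      let ?R = "proj a b (concat (map (\<lambda>i. clique_word (\<xi>' i)) [n..<j]))"
      let ?S = "proj a b (concat (map (\<lambda>i. clique_word (\<xi>' i)) [j..<m]))"
      have "[n..<m] = [n..<j] @ [j..<m]"
        using j by (metis le_add_diff_inverse less_or_eq_imp_le upt_add_eq_append)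
      then have "proj a b (head_word \<xi>' m) = ?Q @ ?R @ ?S"
        by (simp add: head_word_split[OF nm(1)])
      moreover have "proj a b (head_word \<xi> (Suc n)) = ?P @ [b]"
        using proj_clique_word[OF gen_traces_clique[OF g(1)] a(2) b(1)] by (simp add: head_word_Suc)
      ultimately have PQ: "prefix (?P @ [b]) (?Q @ ?R @ ?S)"
        using Suc.prems a(2) unfolding word_le_def by metis
      have "prefix ?P ?Q" using IH a(2) by (simp add: word_le_def)
      then obtain Q' where Q': "?Q = ?P @ Q'" by (auto simp: prefix_def)
      have "count_list ?Q b = count_list ?P b"
        using b(3) by (simp add: count_proj)
      then have "b \<notin> set Q'" using Q' count_list_0_iff by fastforce
      moreover have "prefix [b] (Q' @ ?R @ ?S)" using PQ Q' by simp
      ultimately have "Q' = []" by (cases Q') auto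
      then have "prefix [b] (?R @ ?S)" using PQ Q' by simp
      moreover have "b \<notin> set ?R" using before by (auto simp: set_proj clique_word)
      moreover have "j - 1 \<in> {n..<j}" using \<open>n < j\<close> by auto
      with a(1) have "\<exists>i\<in>{n..<j}. a \<in> \<xi>' i" by blast
      then have "a \<in> set ?R" by (simp add: set_proj clique_word)
      ultimately show False by (cases ?R) auto
    qed
  qed
qed simp

text \<open>
  Uniqueness of the normal form: by the comparison of levels in both directions, the first \<open>m\<close>
  cliques have the same product for every \<open>m \<le> n\<close>, and letter counts then separate the cliques.
\<close>
lemma head_word_inj:
  assumes g: "\<xi> \<in> gen_traces I" "\<xi>' \<in> gen_traces I"
    and eq: "(head_word \<xi> n, head_word \<xi>' n) \<in> trace_cong I" and i: "i < n"
  shows "\<xi> i = \<xi>' i"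
proof -
  have le: "word_le I (head_word \<xi> m) (head_word \<xi>' m)"
    if "m \<le> n" "\<xi> \<in> gen_traces I" "\<xi>' \<in> gen_traces I"
      "(head_word \<xi> n, head_word \<xi>' n) \<in> trace_cong I" for m \<xi> \<xi>'
  proof (rule head_word_le_level[OF that(2,3), of m n])
    show "word_le I (head_word \<xi> m) (head_word \<xi>' n)"
      using head_word_mono[OF that(1), of \<xi>] word_le_cong[OF trace_cong.refl that(4)] by blast
  qed
  have "(head_word \<xi> m, head_word \<xi>' m) \<in> trace_cong I" if "m \<le> n" for m
    using le[OF that g eq] le[OF that g(2,1) trace_cong.sym[OF eq]] word_le_antisym by blast
  then have "count_list (head_word \<xi> i) b = count_list (head_word \<xi>' i) b"
    "count_list (head_word \<xi> (Suc i)) b = count_list (head_word \<xi>' (Suc i)) b" for b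
    using i cong_count by (meson Suc_leI less_imp_le)+
  then have "count_list (clique_word (\<xi> i)) b = count_list (clique_word (\<xi>' i)) b" for b
    by (metis add_left_cancel count_list_append head_word_Suc)
  then have "b \<in> \<xi> i \<longleftrightarrow> b \<in> \<xi>' i" for b
    unfolding count_clique_word by (metis zero_neq_one)
  then show ?thesis by blast
qed

lemma head_word_const:
  assumes "\<And>i. n \<le> i \<Longrightarrow> \<xi> i = {}" "n \<le> m"
  shows "head_word \<xi> m = head_word \<xi> n"
  using assms by (simp add: head_word_split)

text \<open>
  The first clique consists of all letters that can be moved to the front; it is split off and the
  rest is treated by induction. A letter of the next clique that depended on no letter of the first
  one could be moved to the front as well.
\<close>
lemma normal_form_exists:
  "\<exists>\<xi> n. \<xi> \<in> gen_traces I \<and> (\<forall>i<n. \<xi> i \<noteq> {}) \<and> (\<forall>i\<ge>n. \<xi> i = {}) \<and> (x, head_word \<xi> n) \<in> trace_cong I"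
proof (induction "length x" arbitrary: x rule: less_induct)
  case less
  show ?case
  proof (cases "x = []")
    case True
    then show ?thesis
      by (intro exI[of _ "\<lambda>_. {}"] exI[of _ 0])
        (auto simp: gen_traces_def clique_def clique_arrow_def trace_cong.refl)
  next
    case False
    define c where "c = {b. word_le I [b] x}"
    have cl: "clique I c"
      unfolding clique_def
    proof (intro ballI impI, rule ccontr)
      fix a b assume ab: "a \<in> c" "b \<in> c" "a \<noteq> b" "(a, b) \<notin> I"
      then have "prefix (proj a b [a]) (proj a b x)" "prefix (proj a b [b]) (proj a b x)"
        by (auto simp: c_def word_le_def)
      then have "prefix [a] (proj a b x)" "prefix [b] (proj a b x)"
        by (auto simp: proj_Cons)
      then show False using ab(3) by (cases "proj a b x") auto
    qed
    have "word_le I (clique_word c) x"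
      unfolding word_le_def
    proof (intro allI impI)
      fix a b assume ab: "(a, b) \<notin> I"
      then have ba: "(b, a) \<notin> I" using I_symD by blast
      consider "a \<in> c" | "b \<in> c" | "a \<notin> c" "b \<notin> c" by blast
      then show "prefix (proj a b (clique_word c)) (proj a b x)"
      proof cases
        case 1
        then have "prefix (proj b a [a]) (proj b a x)" using ba by (simp add: c_def word_le_def)
        then have "prefix [a] (proj b a x)" by (simp add: proj_Cons)
        then show ?thesis
          using proj_clique_word[OF cl ba 1] by (simp add: proj_commute[of a b])
      next
        case 2
        then have "prefix (proj a b [b]) (proj a b x)" using ab by (simp add: c_def word_le_def)
        then have "prefix [b] (proj a b x)" by (simp add: proj_Cons)
        then show ?thesis using proj_clique_word[OF cl ab 2] by simp
      next
        case 3
        then have "proj a b (clique_word c) = []" by (simp add: proj_eq_Nil clique_word)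
        then show ?thesis by simp
      qed
    qed
    then obtain x' where x': "(x, clique_word c @ x') \<in> trace_cong I"
      using word_le_iff_factor by blast
    obtain a w where "x = a # w" using False by (cases x) auto
    then have "a \<in> c" by (simp add: c_def word_le_append[of I "[a]" w, simplified])
    then have "clique_word c \<noteq> []" using clique_word(2)[of c] by auto
    moreover have "length x = length (clique_word c @ x')"
      using x' by (metis trace_class_eq_iff trace_length_class)
    ultimately have "length x' < length x" by simp
    then obtain \<xi> n where \<xi>: "\<xi> \<in> gen_traces I" "\<forall>i<n. \<xi> i \<noteq> {}" "\<forall>i\<ge>n. \<xi> i = {}"
      "(x', head_word \<xi> n) \<in> trace_cong I"
      using less by blast
    have arrow: "clique_arrow I c (\<xi> 0)"
      unfolding clique_arrow_def
    proof (intro ballI, rule ccontr)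
      fix b assume b: "b \<in> \<xi> 0" and "\<not> (\<exists>a\<in>c. (a, b) \<notin> I)"
      then have indep: "(a, b) \<in> I" if "a \<in> c" for a using that by blast
      then have "b \<notin> c" using not_I_refl by blast
      have "0 < n" using b \<xi>(3) by (metis empty_iff gr0I le0)
      have "word_le I [b] (head_word \<xi> n)"
        unfolding word_le_def
      proof (intro allI impI)
        fix p q assume pq: "(p, q) \<notin> I"
        then have qp: "(q, p) \<notin> I" using I_symD by blast
        have w: "head_word \<xi> n = clique_word (\<xi> 0) @ concat (map (\<lambda>i. clique_word (\<xi> i)) [1..<n])"
          using \<open>0 < n\<close> head_word_split[of 1 n \<xi>] by (simp add: head_word_Suc)
        show "prefix (proj p q [b]) (proj p q (head_word \<xi> n))"
          using b proj_clique_word[OF gen_traces_clique[OF \<xi>(1)] pq, of 0]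
            proj_clique_word[OF gen_traces_clique[OF \<xi>(1)] qp, of 0]
          by (auto simp: w proj_Cons proj_commute[of p q])
      qed
      then have bx': "word_le I [b] x'" using word_le_cong[OF trace_cong.refl \<xi>(4)] by blast
      have "word_le I [b] (clique_word c @ x')"
        unfolding word_le_def
      proof (intro allI impI)
        fix p q assume pq: "(p, q) \<notin> I"
        then have qp: "(q, p) \<notin> I" using I_symD by blast
        have *: "prefix (proj p q [b]) (proj p q x')" using bx' pq by (simp add: word_le_def)
        show "prefix (proj p q [b]) (proj p q (clique_word c @ x'))"
        proof (cases "b = p \<or> b = q")
          case True
          then have "p \<notin> c" "q \<notin> c" using \<open>b \<notin> c\<close> indep pq qp by blast+
          then have "proj p q (clique_word c) = []" by (simp add: proj_eq_Nil clique_word)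
          then show ?thesis using * by simp
        qed (simp add: proj_Cons)
      qed
      then have "word_le I [b] x" using word_le_cong[OF trace_cong.refl x'] by blast
      then show False using \<open>b \<notin> c\<close> by (simp add: c_def)
    qed
    let ?\<xi> = "case_nat c \<xi>"
    have "?\<xi> \<in> gen_traces I"
      using \<xi>(1) cl arrow unfolding gen_traces_def by (auto split: nat.split)
    moreover have "\<forall>i<Suc n. ?\<xi> i \<noteq> {}" "\<forall>i\<ge>Suc n. ?\<xi> i = {}"
      using \<xi>(2,3) \<open>a \<in> c\<close> by (auto split: nat.split)
    moreover have "(x, head_word ?\<xi> (Suc n)) \<in> trace_cong I"
      using x' trace_cong_append_left[OF \<xi>(4), of "clique_word c"]
      unfolding head_word_case_nat by (rule trace_cong.trans)
    ultimately show ?thesis by blast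
  qed
qed

lemma normal_form_unique:
  assumes "\<xi> \<in> gen_traces I" "\<forall>i\<ge>n. \<xi> i = {}"
    and "\<xi>' \<in> gen_traces I" "\<forall>i\<ge>n'. \<xi>' i = {}"
    and "(head_word \<xi> n, head_word \<xi>' n') \<in> trace_cong I"
  shows "\<xi> = \<xi>'"
proof
  fix i
  let ?N = "max (Suc i) (max n n')"
  have "(head_word \<xi> ?N, head_word \<xi>' ?N) \<in> trace_cong I"
    using assms head_word_const[of n \<xi> ?N] head_word_const[of n' \<xi>' ?N] by simp
  then show "\<xi> i = \<xi>' i" using assms head_word_inj[of \<xi> \<xi>' ?N i] by simp
qed

lemma normal_form_eqI:
  assumes "\<xi> \<in> gen_traces I" "\<forall>i<n. \<xi> i \<noteq> {}" "\<forall>i\<ge>n. \<xi> i = {}"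
    and "(w, head_word \<xi> n) \<in> trace_cong I"
  shows "normal_form I (trace_class I w) = \<xi>"
  unfolding normal_form_def
proof (rule the_equality)
  show "\<xi> \<in> gen_traces I \<and> (\<exists>n. (\<forall>i<n. \<xi> i \<noteq> {}) \<and> (\<forall>i\<ge>n. \<xi> i = {}) \<and>
      trace_class I w = head_trace I \<xi> n)"
    using assms by (auto simp: head_trace_eq trace_class_eq_iff)
next
  fix \<xi>'
  assume "\<xi>' \<in> gen_traces I \<and> (\<exists>n. (\<forall>i<n. \<xi>' i \<noteq> {}) \<and> (\<forall>i\<ge>n. \<xi>' i = {}) \<and>
      trace_class I w = head_trace I \<xi>' n)"
  then obtain n' where "\<xi>' \<in> gen_traces I" "\<forall>i\<ge>n'. \<xi>' i = {}" "(w, head_word \<xi>' n') \<in> trace_cong I"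
    by (auto simp: head_trace_eq trace_class_eq_iff)
  then show "\<xi>' = \<xi>"
    using assms normal_form_unique[of \<xi>' n' \<xi> n]
    by (meson trace_cong.sym trace_cong.trans)
qed

lemma normal_form:
  obtains \<xi> n where "normal_form I (trace_class I w) = \<xi>" "\<xi> \<in> gen_traces I"
    "\<forall>i\<ge>n. \<xi> i = {}" "(w, head_word \<xi> n) \<in> trace_cong I"
proof -
  obtain \<xi> n where "\<xi> \<in> gen_traces I" "\<forall>i<n. \<xi> i \<noteq> {}" "\<forall>i\<ge>n. \<xi> i = {}"
    "(w, head_word \<xi> n) \<in> trace_cong I"
    using normal_form_exists[of w] by blast
  with that[of \<xi> n] normal_form_eqI[of \<xi> n w] show thesis by blast
qed

lemma trace_le_iff: "trace_le I (trace_class I u) (trace_class I v) \<longleftrightarrow> word_le I u v"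
  unfolding trace_le_def carrier_trace_monoid word_le_iff_factor
  by (auto simp: trace_class_mult trace_class_eq_iff)

lemma trace_le_inf_iff: "trace_le_inf I (trace_class I u) \<xi> \<longleftrightarrow> (\<exists>n. word_le I u (head_word \<xi> n))"
  by (simp add: trace_le_inf_def head_trace_eq trace_le_iff)

lemma trace_le_inf_normal_form:
  "trace_le_inf I (trace_class I u) (normal_form I (trace_class I w)) \<longleftrightarrow> word_le I u w"
proof -
  obtain \<xi> n where \<xi>: "normal_form I (trace_class I w) = \<xi>" "\<xi> \<in> gen_traces I"
    "\<forall>i\<ge>n. \<xi> i = {}" "(w, head_word \<xi> n) \<in> trace_cong I"
    by (rule normal_form[of w])
  have "word_le I u (head_word \<xi> n)" if "word_le I u (head_word \<xi> m)" for m
    using that head_word_const[of n \<xi> m] \<xi>(3) head_word_mono[of m n \<xi>] word_le_trans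
    by (metis nat_le_linear)
  then show ?thesis
    unfolding \<xi>(1) trace_le_inf_iff using word_le_cong[OF trace_cong.refl \<xi>(4)] by blast
qed

text \<open>
  The comparison of levels bounds the existential quantifier in the prefix relation, so cones whose
  apex has \<open>n\<close> levels are determined by the first \<open>n\<close> cliques.
\<close>
lemma trace_le_inf_head:
  assumes "\<xi> \<in> gen_traces I" "\<xi>' \<in> gen_traces I"
  shows "trace_le_inf I (head_trace I \<xi> n) \<xi>' \<longleftrightarrow> word_le I (head_word \<xi> n) (head_word \<xi>' n)"
  unfolding head_trace_eq trace_le_inf_iff using head_word_le_level[OF assms] by blast

lemma normal_form_gen: "x \<in> carrier (trace_monoid I) \<Longrightarrow> normal_form I x \<in> gen_traces I"
  unfolding carrier_trace_monoid using normal_form by (metis imageE)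

text \<open>
  Only empty cliques can follow an empty clique, so a generalized trace with an empty clique is the
  normal form of a finite trace.
\<close>
lemma infinite_traces_nonempty:
  assumes "\<omega> \<in> infinite_traces I"
  shows "\<omega> i \<noteq> {}"
proof
  assume "\<omega> i = {}"
  define n where "n = (LEAST i. \<omega> i = {})"
  have n: "\<omega> n = {}" unfolding n_def using \<open>\<omega> i = {}\<close> by (rule LeastI)
  have g: "\<omega> \<in> gen_traces I" using assms by (simp add: infinite_traces_def)
  have "\<omega> j = {}" if "n \<le> j" for j
    using that
  proof (induction j rule: dec_induct)
    case (step j)
    then have "b \<notin> \<omega> (Suc j)" for b
      using gen_traces_pred[OF g, of b "Suc j"] by auto
    then show ?case by blast
  qed (use n in simp)
  moreover have "\<forall>i<n. \<omega> i \<noteq> {}" unfolding n_def using not_less_Least by blast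
  ultimately have "normal_form I (trace_class I (head_word \<omega> n)) = \<omega>"
    using g by (intro normal_form_eqI[of _ n]) (auto intro: trace_cong.refl)
  then have "\<omega> \<in> normal_form I ` carrier (trace_monoid I)"
    unfolding carrier_trace_monoid by (metis imageI rangeI)
  then show False using assms by (simp add: infinite_traces_def)
qed

lemma length_head_word_infinite:
  assumes "\<omega> \<in> infinite_traces I"
  shows "n \<le> length (head_word \<omega> n)"
proof (induction n)
  case (Suc n)
  have "clique_word (\<omega> n) \<noteq> []"
    using infinite_traces_nonempty[OF assms, of n] clique_word(2)[of "\<omega> n"] by auto
  then show ?case using Suc by (cases "clique_word (\<omega> n)") (auto simp: head_word_Suc)
qed simp

lemma infinite_trace_has_prefix:
  assumes "\<omega> \<in> infinite_traces I"
  shows "\<exists>x\<in>carrier (trace_monoid I). trace_length x = n \<and> trace_le_inf I x \<omega>"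
proof
  let ?w = "take n (head_word \<omega> n)"
  have "word_le I ?w (head_word \<omega> n)"
    using word_le_append[of I ?w "drop n (head_word \<omega> n)"] by simp
  then show "trace_length (trace_class I ?w) = n \<and> trace_le_inf I (trace_class I ?w) \<omega>"
    using length_head_word_infinite[OF assms, of n]
    by (auto simp: trace_length_class trace_le_inf_iff)
qed (simp add: carrier_trace_monoid)

lemma trace_le_inf_common:
  assumes "trace_le_inf I (trace_class I u) \<xi>" "trace_le_inf I (trace_class I v) \<xi>"
  obtains h where "word_le I u h" "word_le I v h"
proof -
  obtain n m where "word_le I u (head_word \<xi> n)" "word_le I v (head_word \<xi> m)"
    using assms by (auto simp: trace_le_inf_iff)
  then show thesis
    using that[of "head_word \<xi> (max n m)"] head_word_mono word_le_trans by (meson max.cobounded1 max.cobounded2)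
qed

end

section \<open>Traces and the first occurrence of a letter\<close>

definition letters :: "'a list set \<Rightarrow> 'a set" where
  "letters x = \<Union>(set ` x)"

definition parikh :: "'a list set \<Rightarrow> 'a \<Rightarrow> nat" where
  "parikh x = count_list (SOME w. w \<in> x)"

context trace_alphabet begin

abbreviation M :: "'a list set set" where "M \<equiv> carrier (trace_monoid I)"

abbreviation tmult :: "'a list set \<Rightarrow> 'a list set \<Rightarrow> 'a list set" (infixl "\<odot>" 70) where
  "x \<odot> y \<equiv> x \<otimes>\<^bsub>trace_monoid I\<^esub> y"

lemma traceE:
  assumes "x \<in> M"
  obtains w where "x = trace_class I w"
  using assms by (auto simp: carrier_trace_monoid)

lemma trace_class_in [simp]: "trace_class I w \<in> M"
  by (simp add: carrier_trace_monoid)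

lemma tmult_in [simp]: "x \<in> M \<Longrightarrow> y \<in> M \<Longrightarrow> x \<odot> y \<in> M"
  by (elim traceE) (simp add: trace_class_mult)

lemma one_eq: "\<one>\<^bsub>trace_monoid I\<^esub> = trace_class I []"
  by (simp add: trace_monoid_def)

lemma letters_class [simp]: "letters (trace_class I w) = set w"
proof -
  have "set u = set w" if "u \<in> trace_class I w" for u
    using that cong_set[of w u] by (simp add: trace_class_def)
  then have "letters (trace_class I w) = (\<Union>u\<in>trace_class I w. set w)"
    unfolding letters_def by (rule SUP_cong[OF HOL.refl])
  also have "\<dots> = set w" using trace_class_self[of w I] by auto
  finally show ?thesis .
qed

lemma parikh_class [simp]: "parikh (trace_class I w) = count_list w"
proof -
  have "(SOME u. u \<in> trace_class I w) \<in> trace_class I w"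
    by (rule someI) (rule trace_class_self)
  then have "(w, SOME u. u \<in> trace_class I w) \<in> trace_cong I"
    by (simp add: trace_class_def)
  from cong_count[OF this] show ?thesis by (simp add: parikh_def fun_eq_iff)
qed

lemma letters_mult: "x \<in> M \<Longrightarrow> y \<in> M \<Longrightarrow> letters (x \<odot> y) = letters x \<union> letters y"
  by (elim traceE) (simp add: trace_class_mult)

lemma trace_length_mult: "x \<in> M \<Longrightarrow> y \<in> M \<Longrightarrow> trace_length (x \<odot> y) = trace_length x + trace_length y"
  by (elim traceE) (simp add: trace_class_mult trace_length_class)

lemma parikh_mult: "x \<in> M \<Longrightarrow> y \<in> M \<Longrightarrow> parikh (x \<odot> y) b = parikh x b + parikh y b"
  by (elim traceE) (simp add: trace_class_mult)

lemma parikh_pos_iff: "x \<in> M \<Longrightarrow> 0 < parikh x b \<longleftrightarrow> b \<in> letters x"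
  by (elim traceE) (simp add: count_list_0_iff flip: neq0_conv)

lemma trace_length_parikh: "x \<in> M \<Longrightarrow> trace_length x = (\<Sum>b\<in>UNIV. parikh x b)"
  by (elim traceE) (simp add: trace_length_class sum_count_set)

lemma tmult_cancel_left: "x \<in> M \<Longrightarrow> y \<in> M \<Longrightarrow> z \<in> M \<Longrightarrow> x \<odot> y = x \<odot> z \<Longrightarrow> y = z"
  by (elim traceE) (simp add: trace_class_mult trace_class_eq_iff cong_cancel_left)

lemma parikh_unique:
  assumes "x \<in> M" "y \<in> M" "trace_le_inf I x \<xi>" "trace_le_inf I y \<xi>" "parikh x = parikh y"
  shows "x = y"
proof -
  obtain u v where uv: "x = trace_class I u" "y = trace_class I v"
    using assms(1,2) by (metis traceE)
  obtain h where "word_le I u h" "word_le I v h"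
    using trace_le_inf_common assms(3,4) unfolding uv by blast
  moreover have "count_list u a = count_list v a" for a
    using assms(5) unfolding uv by (simp add: fun_eq_iff)
  ultimately show ?thesis
    unfolding uv trace_class_eq_iff by (intro cong_if_count_eq)
qed

text \<open>
  The traces \<open>u b\<close> in which everything lies below their only \<open>b\<close>; equivalently, the minimal ones
  among the traces that contain \<open>b\<close>. They are the possible parts of a longer trace below its first
  \<open>b\<close>.
\<close>
definition first_ideals :: "'a \<Rightarrow> 'a list set set" where
  "first_ideals b = {x \<in> M. b \<in> letters x \<and> (\<forall>y\<in>M. trace_le I y x \<longrightarrow> b \<in> letters y \<longrightarrow> y = x)}"

lemma first_ideal_exists:
  assumes "x \<in> M" "b \<in> letters x"
  obtains p z where "p \<in> first_ideals b" "z \<in> M" "x = p \<odot> z"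
proof -
  obtain w where w: "x = trace_class I w" using assms by (auto elim: traceE)
  define Q where "Q u \<longleftrightarrow> word_le I u w \<and> b \<in> set u" for u
  have "Q w" using assms w by (simp add: Q_def)
  then obtain u where u: "Q u" and least: "\<And>v. Q v \<Longrightarrow> length u \<le> length v"
    using ex_has_least_nat[of Q w length] by blast
  have "trace_class I u \<in> first_ideals b"
    unfolding first_ideals_def
  proof (intro CollectI conjI ballI impI)
    fix y assume y: "y \<in> M" "trace_le I y (trace_class I u)" "b \<in> letters y"
    obtain v where v: "y = trace_class I v" using y(1) by (rule traceE)
    have vu: "word_le I v u" using y(2) v by (simp add: trace_le_iff)
    then have "Q v" using u y(3) v word_le_trans by (auto simp: Q_def)
    obtain z where z: "(u, v @ z) \<in> trace_cong I" using vu word_le_iff_factor by blast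
    then have "length u = length v + length z"
      by (metis length_append trace_class_eq_iff trace_length_class)
    then have "z = []" using least[OF \<open>Q v\<close>] by simp
    then show "y = trace_class I u" using z v trace_class_eq_iff by (metis append_Nil2)
  qed (use u in \<open>auto simp: Q_def\<close>)
  moreover obtain z where "(w, u @ z) \<in> trace_cong I"
    using u word_le_iff_factor by (auto simp: Q_def)
  then have "x = trace_class I u \<odot> trace_class I z"
    by (simp add: w trace_class_mult trace_class_eq_iff)
  ultimately show thesis by (intro that[of "trace_class I u" "trace_class I z"]) simp_all
qed

text \<open>
  The meet of two traces below the same generalized trace still contains \<open>b\<close> if both of them do, so
  by minimality it equals both.
\<close>
lemma first_ideal_unique:
  assumes "p \<in> first_ideals b" "q \<in> first_ideals b" "trace_le_inf I p \<xi>" "trace_le_inf I q \<xi>"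
  shows "p = q"
proof -
  obtain u v where uv: "p = trace_class I u" "q = trace_class I v"
    using assms(1,2) unfolding first_ideals_def by (metis (no_types, lifting) mem_Collect_eq traceE)
  then have b: "b \<in> set u" "b \<in> set v" using assms by (auto simp: first_ideals_def)
  obtain h where "word_le I u h" "word_le I v h"
    using trace_le_inf_common assms(3,4) unfolding uv by blast
  then obtain m where m: "word_le I m u" "word_le I m v"
    "\<forall>a. count_list m a = min (count_list u a) (count_list v a)"
    using word_le_meet by blast
  have "count_list u b \<noteq> 0" "count_list v b \<noteq> 0" using b count_list_0_iff by metis+
  then have "count_list m b \<noteq> 0" using m(3) by simp
  then have "b \<in> set m" using count_list_0_iff by metis
  then have "b \<in> letters (trace_class I m)" by simp
  then have "trace_class I m = p" "trace_class I m = q"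
    using assms(1,2) m(1,2) uv by (auto simp: first_ideals_def trace_le_iff)
  then show ?thesis by simp
qed

lemma finite_traces_of_length: "finite {x \<in> M. trace_length x = n}"
proof (rule finite_subset)
  show "{x \<in> M. trace_length x = n} \<subseteq> trace_class I ` {w. set w \<subseteq> UNIV \<and> length w = n}"
    by (auto elim!: traceE simp: trace_length_class)
  show "finite (trace_class I ` {w. set w \<subseteq> UNIV \<and> length w = n})"
    by (intro finite_imageI finite_lists_length_eq) simp
qed

section \<open>Cylinders and cones are open\<close>

lemma topspace_gen: "topspace (gen_trace_topology I) = gen_traces I"
  by (auto simp: gen_trace_topology_def gen_traces_def)

lemma openin_cylinder:
  assumes "\<xi> \<in> gen_traces I"
  shows "openin (gen_trace_topology I) {\<xi>' \<in> gen_traces I. \<forall>i<n. \<xi>' i = \<xi> i}"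
proof -
  let ?B = "PiE UNIV (\<lambda>i. if i < n then {\<xi> i} else {c. clique I c})"
  have "openin (product_topology (\<lambda>_. discrete_topology {c. clique I c}) UNIV) ?B"
  proof -
    have "finite {i. (if i < n then {\<xi> i} else {c. clique I c}) \<noteq> {c. clique I c}}"
      by (rule finite_subset[of _ "{..<n}"]) auto
    then show ?thesis
      using assms by (subst openin_PiE_gen) (auto simp: gen_traces_clique)
  qed
  moreover have "{\<xi>' \<in> gen_traces I. \<forall>i<n. \<xi>' i = \<xi> i} = ?B \<inter> gen_traces I"
    by (auto simp: PiE_iff gen_traces_clique split: if_splits)
  ultimately show ?thesis
    unfolding gen_trace_topology_def openin_subtopology by blast
qed

lemma openin_if_finitely_determined:
  assumes "S \<subseteq> gen_traces I"
    and "\<And>\<xi>. \<xi> \<in> S \<Longrightarrow> \<exists>n. \<forall>\<xi>'\<in>gen_traces I. (\<forall>i<n. \<xi>' i = \<xi> i) \<longrightarrow> \<xi>' \<in> S"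
  shows "openin (gen_trace_topology I) S"
proof (subst openin_subopen, intro ballI)
  fix \<xi> assume \<xi>: "\<xi> \<in> S"
  then obtain n where "\<forall>\<xi>'\<in>gen_traces I. (\<forall>i<n. \<xi>' i = \<xi> i) \<longrightarrow> \<xi>' \<in> S"
    using assms by blast
  then show "\<exists>T. openin (gen_trace_topology I) T \<and> \<xi> \<in> T \<and> T \<subseteq> S"
    using openin_cylinder[of \<xi> n] \<xi> assms(1)
    by (intro exI[of _ "{\<xi>' \<in> gen_traces I. \<forall>i<n. \<xi>' i = \<xi> i}"]) auto
qed

lemma openin_above: 
  assumes "x \<in> M"
  shows "openin (gen_trace_topology I) {\<xi> \<in> gen_traces I. trace_le_inf I x \<xi>}"
proof (rule openin_if_finitely_determined)
  fix \<xi> assume \<xi>: "\<xi> \<in> {\<xi> \<in> gen_traces I. trace_le_inf I x \<xi>}"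
  then obtain n where n: "trace_le I x (head_trace I \<xi> n)" by (auto simp: trace_le_inf_def)
  have "trace_le_inf I x \<xi>'" if "\<forall>i<n. \<xi>' i = \<xi> i" for \<xi>'
  proof -
    have "head_word \<xi>' n = head_word \<xi> n" using that by (intro head_word_cong) simp
    then show ?thesis using n unfolding trace_le_inf_def head_trace_eq by metis
  qed
  then show "\<exists>n. \<forall>\<xi>'\<in>gen_traces I. (\<forall>i<n. \<xi>' i = \<xi> i) \<longrightarrow>
      \<xi>' \<in> {\<xi> \<in> gen_traces I. trace_le_inf I x \<xi>}"
    by blast
qed auto

lemma space_borel_of: "space (borel_of T) = topspace T"
  unfolding borel_of_def by (intro space_measure_of) (auto dest: openin_subset)

lemma sets_borel_of: "sets (borel_of T) = sigma_sets (topspace T) {U. openin T U}"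
  unfolding borel_of_def by (intro sets_measure_of) (auto dest: openin_subset)

lemma sets_borel_of_open: "openin T U \<Longrightarrow> U \<in> sets (borel_of T)"
  by (simp add: sets_borel_of)

lemma infinite_subset_gen: "infinite_traces I \<subseteq> gen_traces I"
  by (auto simp: infinite_traces_def)

end

section \<open>Valuations and generating series\<close>

locale markov_system =
  fixes I :: "('a::finite \<times> 'a) set"
    and act :: "'s::finite option \<Rightarrow> 'a list set \<Rightarrow> 's option"
    and \<nu> :: "'s \<Rightarrow> (nat \<Rightarrow> 'a set) measure"
  assumes system: "concurrent_system I act"
    and markov: "markov_measure I act \<nu>"

sublocale markov_system \<subseteq> trace_alphabet I
  using system by unfold_locales (simp_all add: concurrent_system_def)

context markov_system begin

lemma prob_space_nu: "prob_space (\<nu> \<beta>)"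
  using markov by (simp add: markov_measure_def)

lemma sets_nu: "sets (\<nu> \<beta>) = sets (borel_of (subtopology (gen_trace_topology I) (infinite_traces I)))"
  using markov by (simp add: markov_measure_def)

lemma space_nu: "space (\<nu> \<beta>) = infinite_traces I"
  using sets_eq_imp_space_eq[OF sets_nu] infinite_subset_gen
  by (simp add: space_borel_of topspace_gen Int_absorb1)

lemma sets_nu_Int:
  assumes "openin (gen_trace_topology I) U"
  shows "U \<inter> infinite_traces I \<in> sets (\<nu> \<beta>)"
  unfolding sets_nu using assms by (intro sets_borel_of_open) (auto simp: openin_subtopology)

lemma up_eq: "up I x = {\<xi> \<in> gen_traces I. trace_le_inf I x \<xi>} \<inter> infinite_traces I"
  using infinite_subset_gen by (auto simp: up_def)

lemma sets_up [measurable]: "x \<in> M \<Longrightarrow> up I x \<in> sets (\<nu> \<beta>)"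
  unfolding up_eq by (intro sets_nu_Int openin_above)

abbreviation val :: "'s \<Rightarrow> 'a list set \<Rightarrow> real" where
  "val \<equiv> valuation I \<nu>"

text \<open>The value at the sink is \<open>0\<close>, so that the chain rule has a uniform right-hand side.\<close>
definition opt_val :: "('s \<Rightarrow> real) \<Rightarrow> 's option \<Rightarrow> real" where
  "opt_val g p = (case p of None \<Rightarrow> 0 | Some \<beta> \<Rightarrow> g \<beta>)"

lemma opt_val_simps [simp]: "opt_val g None = 0" "opt_val g (Some \<beta>) = g \<beta>"
  by (simp_all add: opt_val_def)

lemma val_nonneg: "0 \<le> val \<beta> x"
  by (simp add: valuation_def)

lemma val_mult:
  assumes "x \<in> M" "y \<in> M"
  shows "val \<beta> (x \<odot> y) = val \<beta> x * opt_val (\<lambda>\<gamma>. val \<gamma> y) (act (Some \<beta>) x)"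
  using assms markov by (simp add: markov_measure_def valuation_def opt_val_def)

lemma val_pos_iff: "x \<in> M \<Longrightarrow> 0 < val \<beta> x \<longleftrightarrow> act (Some \<beta>) x \<noteq> None"
  using markov by (auto simp: markov_measure_def valuation_def traces_from_def)

lemma val_one: "val \<beta> (trace_class I []) = 1"
proof -
  have "up I (trace_class I []) = space (\<nu> \<beta>)"
    by (auto simp: up_def space_nu trace_le_inf_iff)
  then show ?thesis
    using prob_space.prob_space[OF prob_space_nu] by (simp add: valuation_def)
qed

lemma act_mult: "x \<in> M \<Longrightarrow> y \<in> M \<Longrightarrow> act p (x \<odot> y) = act (act p x) y"
  using system by (simp add: concurrent_system_def)

lemma act_None: "x \<in> M \<Longrightarrow> act None x = None"
  using system by (simp add: concurrent_system_def)

lemma act_one: "act p (trace_class I []) = p"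
  using system by (simp add: concurrent_system_def one_eq)

lemma sum_val_incompatible:
  assumes "finite X" "X \<subseteq> M"
    and "\<And>x y \<omega>. x \<in> X \<Longrightarrow> y \<in> X \<Longrightarrow> trace_le_inf I x \<omega> \<Longrightarrow> trace_le_inf I y \<omega> \<Longrightarrow> x = y"
  shows "(\<Sum>x\<in>X. val \<beta> x) = measure (\<nu> \<beta>) (\<Union>x\<in>X. up I x)"
proof -
  interpret prob_space "\<nu> \<beta>" by (rule prob_space_nu)
  show ?thesis
    unfolding valuation_def
  proof (rule finite_measure_finite_Union[symmetric])
    show "disjoint_family_on (up I) X"
      using assms(3) by (auto simp: disjoint_family_on_def up_def)
    show "up I ` X \<subseteq> events" using assms(2) by auto
  qed fact
qed

lemma sum_val_incompatible_le_1:
  assumes "finite X" "X \<subseteq> M"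
    and "\<And>x y \<omega>. x \<in> X \<Longrightarrow> y \<in> X \<Longrightarrow> trace_le_inf I x \<omega> \<Longrightarrow> trace_le_inf I y \<omega> \<Longrightarrow> x = y"
  shows "(\<Sum>x\<in>X. val \<beta> x) \<le> 1"
  using sum_val_incompatible[OF assms] prob_space.prob_le_1[OF prob_space_nu] by simp

abbreviation weight :: "'s \<Rightarrow> real \<Rightarrow> 'a list set \<Rightarrow> real" where
  "weight \<beta> s x \<equiv> val \<beta> x * s ^ trace_length x"

lemma weight_nonneg: "0 \<le> s \<Longrightarrow> 0 \<le> weight \<beta> s x"
  by (simp add: val_nonneg)

text \<open>
  Distinct traces with equal letter counts have disjoint cones, so for each vector of letter
  counts the valuations sum to at most \<open>1\<close>. The weights are therefore dominated by the geometric
  series \<open>\<Sum>p. s ^ (\<Sum>b. p b) = (1 / (1 - s)) ^ CARD('a)\<close>.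
\<close>
lemma sum_weight_le:
  assumes s: "0 \<le> s" "s < 1" and F: "finite F" "F \<subseteq> M"
  shows "(\<Sum>x\<in>F. weight \<beta> s x) \<le> (1 / (1 - s)) ^ card (UNIV :: 'a set)"
proof -
  define K where "K = Max (insert 0 (trace_length ` F))"
  have K: "trace_length x \<le> K" if "x \<in> F" for x
    using that F by (simp add: K_def)
  have parikhK: "parikh x b \<le> K" if "x \<in> F" for x b
  proof -
    have "parikh x b \<le> (\<Sum>b\<in>UNIV. parikh x b)" by (rule member_le_sum) auto
    then show ?thesis using K[OF that] F that trace_length_parikh[of x] by auto
  qed
  have "(\<Sum>x\<in>F. weight \<beta> s x) = (\<Sum>p\<in>parikh ` F. \<Sum>x | x \<in> F \<and> parikh x = p. weight \<beta> s x)"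
    by (rule sum.image_gen[OF F(1)])
  also have "\<dots> \<le> (\<Sum>p\<in>parikh ` F. \<Prod>b\<in>UNIV. s ^ p b)"
  proof (rule sum_mono)
    fix p assume "p \<in> parikh ` F"
    have "(\<Sum>x | x \<in> F \<and> parikh x = p. weight \<beta> s x)
        = (\<Sum>x | x \<in> F \<and> parikh x = p. val \<beta> x) * (\<Prod>b\<in>UNIV. s ^ p b)"
      unfolding sum_distrib_right
      by (rule sum.cong) (use F in \<open>auto simp: trace_length_parikh power_sum\<close>)
    also have "\<dots> \<le> 1 * (\<Prod>b\<in>UNIV. s ^ p b)"
    proof (rule mult_right_mono[OF sum_val_incompatible_le_1])
      show "x = y" if "x \<in> {x \<in> F. parikh x = p}" "y \<in> {x \<in> F. parikh x = p}"
        "trace_le_inf I x \<omega>" "trace_le_inf I y \<omega>" for x y \<omega>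
        using that F by (intro parikh_unique[of x y \<omega>]) auto
    qed (use F s in \<open>auto intro!: prod_nonneg\<close>)
    finally show "(\<Sum>x | x \<in> F \<and> parikh x = p. weight \<beta> s x) \<le> (\<Prod>b\<in>UNIV. s ^ p b)" by simp
  qed
  also have "\<dots> \<le> (\<Sum>p\<in>PiE (UNIV :: 'a set) (\<lambda>_. {..K}). \<Prod>b\<in>UNIV. s ^ p b)"
    by (rule sum_mono2) (use parikhK s in \<open>auto intro!: finite_PiE prod_nonneg\<close>)
  also have "\<dots> = (\<Prod>b\<in>(UNIV :: 'a set). \<Sum>i\<le>K. s ^ i)"
    by (rule prod_sum_PiE[symmetric]) auto
  also have "\<dots> \<le> (\<Prod>b\<in>(UNIV :: 'a set). 1 / (1 - s))"
  proof (rule prod_mono)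
    have "(\<Sum>i\<le>K. s ^ i) = (1 - s ^ Suc K) / (1 - s)"
      using s sum_gp0[of s K] by simp
    also have "\<dots> \<le> 1 / (1 - s)" using s by (intro divide_right_mono) auto
    finally show "0 \<le> (\<Sum>i\<le>K. s ^ i) \<and> (\<Sum>i\<le>K. s ^ i) \<le> 1 / (1 - s)"
      using s by (auto intro: sum_nonneg)
  qed
  finally show ?thesis by simp
qed

lemma summable_weight:
  assumes "0 \<le> s" "s < 1" "X \<subseteq> M"
  shows "weight \<beta> s summable_on X"
proof (rule nonneg_bdd_above_summable_on)
  show "bdd_above (sum (weight \<beta> s) ` {F. F \<subseteq> X \<and> finite F})"
    using sum_weight_le[OF assms(1,2), of _ \<beta>] assms(3) by (intro bdd_aboveI2) auto
qed (simp add: weight_nonneg assms)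

text \<open>The cones of the traces of length \<open>n\<close> cover all infinite traces.\<close>
lemma sum_val_length_ge_1: "1 \<le> (\<Sum>x | x \<in> M \<and> trace_length x = n. val \<beta> x)"
proof -
  interpret prob_space "\<nu> \<beta>" by (rule prob_space_nu)
  have "space (\<nu> \<beta>) \<subseteq> (\<Union>x\<in>{x \<in> M. trace_length x = n}. up I x)"
    using infinite_trace_has_prefix by (fastforce simp: space_nu up_def)
  moreover have "(\<Union>x\<in>{x \<in> M. trace_length x = n}. up I x) \<in> sets (\<nu> \<beta>)"
    using finite_traces_of_length by (intro sets.finite_UN) auto
  ultimately have "1 \<le> prob (\<Union>x\<in>{x \<in> M. trace_length x = n}. up I x)"
    using finite_measure_mono[of "space (\<nu> \<beta>)" "\<Union>x\<in>{x \<in> M. trace_length x = n}. up I x"]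
      by (simp add: prob_space)
  also have "\<dots> \<le> (\<Sum>x | x \<in> M \<and> trace_length x = n. val \<beta> x)"
    unfolding valuation_def
    by (rule finite_measure_subadditive_finite) (use finite_traces_of_length in auto)
  finally show ?thesis .
qed

definition avoiding :: "'a set \<Rightarrow> 'a list set set" where
  "avoiding A = {x \<in> M. letters x \<inter> A = {}}"

text \<open>For \<open>A = {}\<close> this is the series \<open>G\<close>, for \<open>A = UNIV\<close> only the empty trace is left.\<close>
definition avoiding_series :: "'a set \<Rightarrow> 's \<Rightarrow> real \<Rightarrow> real" where
  "avoiding_series A \<beta> s = (\<Sum>\<^sub>\<infinity>x\<in>avoiding A. weight \<beta> s x)"

lemma avoiding_subset: "avoiding A \<subseteq> M"
  by (auto simp: avoiding_def)

lemma avoiding_empty [simp]: "avoiding {} = M"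
  by (auto simp: avoiding_def)

lemma avoiding_series_nonneg: "0 \<le> s \<Longrightarrow> 0 \<le> avoiding_series A \<beta> s"
  unfolding avoiding_series_def by (intro infsum_nonneg weight_nonneg)

lemma avoiding_series_le: "0 \<le> s \<Longrightarrow> s < 1 \<Longrightarrow> avoiding_series A \<beta> s \<le> avoiding_series {} \<beta> s"
  unfolding avoiding_series_def using avoiding_subset
  by (intro infsum_mono2 summable_weight weight_nonneg) auto

lemma avoiding_series_UNIV: "avoiding_series UNIV \<beta> s = 1"
proof -
  have "avoiding UNIV = {trace_class I []}"
  proof -
    have "x = trace_class I []" if "x \<in> M" "letters x = {}" for x
      using that by (auto elim!: traceE)
    moreover have "letters (trace_class I []) = {}" by simp
    ultimately show ?thesis by (auto simp: avoiding_def)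
  qed
  then show ?thesis by (simp add: avoiding_series_def val_one trace_length_class)
qed

text \<open>The coefficient of every power of \<open>s\<close> is at least \<open>1\<close>.\<close>
lemma avoiding_series_empty_ge:
  assumes s: "0 \<le> s" "s < 1"
  shows "(\<Sum>n<K. s ^ n) \<le> avoiding_series {} \<beta> s"
proof -
  let ?X = "\<lambda>n. {x \<in> M. trace_length x = n}"
  have "(\<Sum>n<K. s ^ n) \<le> (\<Sum>n<K. \<Sum>x\<in>?X n. weight \<beta> s x)"
  proof (rule sum_mono)
    fix n
    have "s ^ n \<le> (\<Sum>x\<in>?X n. val \<beta> x) * s ^ n"
      using sum_val_length_ge_1[of \<beta> n] mult_right_mono[of 1 _ "s ^ n"] s by simp
    also have "\<dots> = (\<Sum>x\<in>?X n. weight \<beta> s x)"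
      by (simp add: sum_distrib_right)
    finally show "s ^ n \<le> (\<Sum>x\<in>?X n. weight \<beta> s x)" .
  qed
  also have "\<dots> = (\<Sum>x\<in>(\<Union>n<K. ?X n). weight \<beta> s x)"
    by (rule sum.UNION_disjoint[symmetric]) (use finite_traces_of_length in auto)
  also have "\<dots> \<le> avoiding_series {} \<beta> s"
    unfolding avoiding_series_def using finite_traces_of_length summable_weight[OF s] weight_nonneg s
    by (intro finite_sum_le_infsum) auto
  finally show ?thesis .
qed

lemma avoiding_series_empty_ge_1: "0 \<le> s \<Longrightarrow> s < 1 \<Longrightarrow> 1 \<le> avoiding_series {} \<beta> s"
  using avoiding_series_empty_ge[of s "Suc 0"] by simp

lemma gen_series_eq: "gen_series I act val \<beta> s = avoiding_series {} \<beta> s"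
  unfolding gen_series_def avoiding_series_def
proof (rule infsum_cong_neutral)
  fix x assume "x \<in> avoiding {} - traces_from I act \<beta>"
  then have "x \<in> M" "act (Some \<beta>) x = None" by (auto simp: traces_from_def)
  then have "val \<beta> x = 0" using val_pos_iff[of x \<beta>] val_nonneg[of \<beta> x] by simp
  then show "weight \<beta> s x = 0" by simp
qed (auto simp: traces_from_def)

text \<open>Summing the chain rule over all traces above \<open>x\<close>, which are the \<open>x \<odot> z\<close>.\<close>
lemma infsum_above:
  assumes x: "x \<in> M"
  shows "(\<Sum>\<^sub>\<infinity>y\<in>{y \<in> M. trace_le I x y}. weight \<beta> s y)
    = weight \<beta> s x * opt_val (\<lambda>\<gamma>. avoiding_series {} \<gamma> s) (act (Some \<beta>) x)"
proof -
  have img: "{y \<in> M. trace_le I x y} = (\<lambda>z. x \<odot> z) ` M"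
    using x by (auto simp: trace_le_def)
  have inj: "inj_on (\<lambda>z. x \<odot> z) M"
    using tmult_cancel_left[OF x] by (intro inj_onI)
  have "(\<Sum>\<^sub>\<infinity>y\<in>{y \<in> M. trace_le I x y}. weight \<beta> s y) = (\<Sum>\<^sub>\<infinity>z\<in>M. weight \<beta> s (x \<odot> z))"
    unfolding img by (simp add: infsum_reindex[OF inj] o_def)
  also have "\<dots> = (\<Sum>\<^sub>\<infinity>z\<in>M. weight \<beta> s x * opt_val (\<lambda>\<gamma>. weight \<gamma> s z) (act (Some \<beta>) x))"
    using x by (intro infsum_cong)
      (auto simp: val_mult trace_length_mult power_add opt_val_def split: option.split)
  also have "\<dots> = weight \<beta> s x * opt_val (\<lambda>\<gamma>. avoiding_series {} \<gamma> s) (act (Some \<beta>) x)"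
    by (cases "act (Some \<beta>) x") (simp_all add: infsum_cmult_right' avoiding_series_def)
  finally show ?thesis .
qed

end

section \<open>Cluster points and boundary edges\<close>

text \<open>
  Compactness along an arbitrary filter: the finer filter \<open>G\<close> plays the role of a convergent
  subsequence.
\<close>
lemma bounded_vector_cluster_point:
  fixes v :: "'b \<Rightarrow> real ^ 's::finite"
  assumes "F \<noteq> bot" and bdd: "eventually (\<lambda>s. \<forall>i. 0 \<le> v s $ i \<and> v s $ i \<le> 1) F"
  obtains G w where "G \<le> F" "G \<noteq> bot" "(v \<longlongrightarrow> w) G"
proof -
  let ?U = "cbox 0 1 :: (real ^ 's) set"
  have "filtermap v F \<noteq> bot" using assms(1) by (simp add: filtermap_bot_iff)
  moreover have "eventually (\<lambda>y. y \<in> ?U) (filtermap v F)"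
    using bdd by (simp add: eventually_filtermap mem_box_cart)
  ultimately obtain w where w: "inf (nhds w) (filtermap v F) \<noteq> bot"
    using compact_cbox[of "0 :: real ^ 's" 1] unfolding compact_filter by blast
  define G where "G = inf F (filtercomap v (nhds w))"
  have "G \<noteq> bot"
  proof
    assume "G = bot"
    then have "eventually (\<lambda>_. False) G" by simp
    then obtain P Q where PQ: "eventually P F" "eventually Q (filtercomap v (nhds w))"
      "\<And>s. P s \<Longrightarrow> Q s \<Longrightarrow> False"
      unfolding G_def eventually_inf by auto
    then obtain R where R: "eventually R (nhds w)" "\<And>s. R (v s) \<Longrightarrow> Q s"
      unfolding eventually_filtercomap by auto
    have "eventually (\<lambda>y. \<not> R y) (filtermap v F)"
      unfolding eventually_filtermap using PQ(1) by (rule eventually_mono) (use PQ(3) R(2) in blast)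
    then have "eventually (\<lambda>_. False) (inf (nhds w) (filtermap v F))"
      using R(1) unfolding eventually_inf by blast
    then show False using w by (simp add: eventually_False)
  qed
  moreover have "(v \<longlongrightarrow> w) G"
    using filterlim_filtercomap[of v "nhds w"] by (rule filterlim_mono) (auto simp: G_def)
  ultimately show thesis using that[of G w] by (simp add: G_def)
qed

lemma rtrancl_crosses_boundary:
  assumes "(x, y) \<in> R\<^sup>*" "x \<in> A" "y \<notin> A"
  obtains a b where "(a, b) \<in> R" "a \<in> A" "b \<notin> A"
proof -
  have "(\<exists>a b. (a, b) \<in> R \<and> a \<in> A \<and> b \<notin> A) \<or> y \<in> A"
    using assms(1,2) by (induction rule: rtrancl_induct) auto
  then show thesis using that assms(3) by blast
qed

section \<open>The recurrence for the part below the first occurrence of a letter\<close>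

context markov_system begin

lemma countable_traces: "countable M"
proof -
  have "M = (\<Union>n. {x \<in> M. trace_length x = n})" by auto
  moreover have "countable (\<Union>n. {x \<in> M. trace_length x = n})"
    by (intro countable_UN[OF countableI_type countable_finite] finite_traces_of_length)
  ultimately show ?thesis by metis
qed

lemma sets_UN_up: "X \<subseteq> M \<Longrightarrow> (\<Union>x\<in>X. up I x) \<in> sets (\<nu> \<beta>)"
  using countable_traces countable_subset by (intro sets.countable_UN'') auto

lemma first_ideals_subset: "first_ideals b \<subseteq> M"
  by (auto simp: first_ideals_def)

text \<open>
  The probability, started at \<open>\<alpha>\<close>, that the part below the first \<open>b\<close> contains no letter of \<open>A\<close>
  and leads to the state \<open>\<gamma>\<close>.
\<close>
definition first_prob :: "'a set \<Rightarrow> 'a \<Rightarrow> 's \<Rightarrow> 's \<Rightarrow> real" where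
  "first_prob A b \<alpha> \<gamma> = measure (\<nu> \<alpha>)
    (\<Union>x\<in>{x \<in> first_ideals b \<inter> avoiding A. act (Some \<alpha>) x = Some \<gamma>}. up I x)"

lemma first_prob_nonneg: "0 \<le> first_prob A b \<alpha> \<gamma>"
  by (simp add: first_prob_def)

lemma sum_val_le_first_prob:
  assumes "finite X" "X \<subseteq> first_ideals b \<inter> avoiding A" "\<And>x. x \<in> X \<Longrightarrow> act (Some \<alpha>) x = Some \<gamma>"
  shows "(\<Sum>x\<in>X. val \<alpha> x) \<le> first_prob A b \<alpha> \<gamma>"
proof -
  interpret prob_space "\<nu> \<alpha>" by (rule prob_space_nu)
  have "X \<subseteq> M" using assms(2) avoiding_subset by blast
  then have "(\<Sum>x\<in>X. val \<alpha> x) = measure (\<nu> \<alpha>) (\<Union>x\<in>X. up I x)"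
    using assms(1,2) first_ideal_unique by (intro sum_val_incompatible) blast+
  also have "\<dots> \<le> first_prob A b \<alpha> \<gamma>"
    unfolding first_prob_def
    by (rule finite_measure_mono) (use assms avoiding_subset in \<open>auto intro!: sets_UN_up\<close>)
  finally show ?thesis .
qed

text \<open>
  The events that make up the transition probabilities are disjoint, and disjoint from the cone
  of any further first ideal that contains a letter of \<open>A\<close>.
\<close>
lemma sum_first_prob_le:
  assumes "X \<subseteq> first_ideals b - avoiding A" "finite X"
  shows "(\<Sum>\<gamma>\<in>UNIV. first_prob A b \<alpha> \<gamma>) + (\<Sum>x\<in>X. val \<alpha> x) \<le> 1"
proof -
  interpret prob_space "\<nu> \<alpha>" by (rule prob_space_nu)
  define V where "V \<gamma> = {x \<in> first_ideals b \<inter> avoiding A. act (Some \<alpha>) x = Some \<gamma>}" for \<gamma>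
  define E where "E Y = (\<Union>x\<in>Y. up I x)" for Y
  have VM: "V \<gamma> \<subseteq> M" for \<gamma> using avoiding_subset by (auto simp: V_def)
  have XM: "X \<subseteq> M" using assms first_ideals_subset by blast
  have disj: "E Y \<inter> E Z = {}"
    if "Y \<subseteq> first_ideals b" "Z \<subseteq> first_ideals b" "Y \<inter> Z = {}" for Y Z
    using that first_ideal_unique unfolding E_def up_def by blast
  have "(\<Sum>\<gamma>\<in>UNIV. first_prob A b \<alpha> \<gamma>) = prob (\<Union>\<gamma>\<in>UNIV. E (V \<gamma>))"
    unfolding first_prob_def V_def[symmetric] E_def[symmetric]
  proof (rule finite_measure_finite_Union[symmetric])
    show "disjoint_family (\<lambda>\<gamma>. E (V \<gamma>))"
      unfolding disjoint_family_on_def by (intro ballI impI disj) (auto simp: V_def)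
  qed (use VM in \<open>auto simp: E_def intro!: sets_UN_up\<close>)
  moreover have "(\<Sum>x\<in>X. val \<alpha> x) = prob (E X)"
    unfolding E_def using assms XM first_ideal_unique by (intro sum_val_incompatible) blast+
  moreover have "prob ((\<Union>\<gamma>\<in>UNIV. E (V \<gamma>)) \<union> E X) = prob (\<Union>\<gamma>\<in>UNIV. E (V \<gamma>)) + prob (E X)"
  proof (rule finite_measure_Union)
    have "E (V \<gamma>) \<inter> E X = {}" for \<gamma>
      using assms by (intro disj) (auto simp: V_def)
    then show "(\<Union>\<gamma>\<in>UNIV. E (V \<gamma>)) \<inter> E X = {}" by blast
  qed (use VM XM in \<open>auto simp: E_def intro!: sets_UN_up sets.finite_UN\<close>)
  ultimately show ?thesis using prob_le_1 by metis
qed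

text \<open>
  A trace that avoids \<open>A\<close> either avoids \<open>b\<close> as well or is the product of a first ideal of \<open>b\<close>
  and a trace, both of which avoid \<open>A\<close>.
\<close>
lemma avoiding_series_recurrence:
  assumes s: "0 \<le> s" "s < 1"
  shows "avoiding_series A \<alpha> s \<le> avoiding_series (insert b A) \<alpha> s + (\<Sum>\<gamma>\<in>UNIV. first_prob A b \<alpha> \<gamma> * avoiding_series A \<gamma> s)"
  unfolding avoiding_series_def[of A \<alpha> s]
proof (rule infsum_le_finite_sums[OF summable_weight[OF s avoiding_subset]])
  fix F assume F: "finite F" "F \<subseteq> avoiding A"
  define F1 where "F1 = {y \<in> F. b \<notin> letters y}"
  define F2 where "F2 = {y \<in> F. b \<in> letters y}"
  have "F = F1 \<union> F2" "F1 \<inter> F2 = {}" by (auto simp: F1_def F2_def)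
  moreover have fin: "finite F1" "finite F2" using F by (auto simp: F1_def F2_def)
  ultimately have "(\<Sum>y\<in>F. weight \<alpha> s y) = (\<Sum>y\<in>F1. weight \<alpha> s y) + (\<Sum>y\<in>F2. weight \<alpha> s y)"
    by (simp add: sum.union_disjoint)
  moreover have "(\<Sum>y\<in>F1. weight \<alpha> s y) \<le> avoiding_series (insert b A) \<alpha> s"
    unfolding avoiding_series_def using F fin s
    by (intro finite_sum_le_infsum summable_weight avoiding_subset weight_nonneg)
      (auto simp: F1_def avoiding_def)
  moreover have "(\<Sum>y\<in>F2. weight \<alpha> s y) \<le> (\<Sum>\<gamma>\<in>UNIV. first_prob A b \<alpha> \<gamma> * avoiding_series A \<gamma> s)"
  proof -
    have "\<exists>p z. p \<in> first_ideals b \<inter> avoiding A \<and> z \<in> avoiding A \<and> y = p \<odot> z" if "y \<in> F2" for y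
    proof -
      have y: "y \<in> M" "b \<in> letters y" "letters y \<inter> A = {}"
        using that F by (auto simp: F2_def avoiding_def)
      obtain p z where pz: "p \<in> first_ideals b" "z \<in> M" "y = p \<odot> z"
        using first_ideal_exists y by blast
      then have "p \<in> M" using first_ideals_subset by blast
      then have "p \<in> avoiding A" "z \<in> avoiding A"
        using pz y letters_mult[of p z] by (auto simp: avoiding_def)
      then show ?thesis using pz by blast
    qed
    then obtain p z where pz: "\<And>y. y \<in> F2 \<Longrightarrow>
        p y \<in> first_ideals b \<inter> avoiding A \<and> z y \<in> avoiding A \<and> y = p y \<odot> z y"
      by metis
    define h where "h x y = val \<alpha> x * opt_val (\<lambda>\<gamma>. weight \<gamma> s y) (act (Some \<alpha>) x)" for x y
    have h0: "0 \<le> h x y" for x y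
      using s by (auto simp: h_def opt_val_def val_nonneg split: option.split)
    have X: "p ` F2 \<subseteq> first_ideals b \<inter> avoiding A" "z ` F2 \<subseteq> avoiding A" using pz by auto
    \<comment> \<open>the factor \<open>s ^ trace_length (p y)\<close> is dropped, which makes the coefficients of the
      recurrence independent of \<open>s\<close>\<close>
    have "(\<Sum>y\<in>F2. weight \<alpha> s y) \<le> (\<Sum>y\<in>F2. h (p y) (z y))"
    proof (rule sum_mono)
      fix y assume y: "y \<in> F2"
      have M: "p y \<in> M" "z y \<in> M" using pz[OF y] avoiding_subset by blast+
      have "weight \<alpha> s y = weight \<alpha> s (p y \<odot> z y)" using pz[OF y] by simp
      also have "\<dots> = s ^ trace_length (p y) * h (p y) (z y)"
        using M by (auto simp: h_def val_mult trace_length_mult power_add opt_val_def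
            split: option.split)
      also have "\<dots> \<le> 1 * h (p y) (z y)"
        using s h0 by (intro mult_right_mono power_le_one) auto
      finally show "weight \<alpha> s y \<le> h (p y) (z y)" by simp
    qed
    also have "\<dots> = (\<Sum>(x, y)\<in>(\<lambda>y. (p y, z y)) ` F2. h x y)"
    proof -
      have "inj_on (\<lambda>y. (p y, z y)) F2"
      proof (rule inj_onI)
        fix y y' assume y: "y \<in> F2" "y' \<in> F2" and "(p y, z y) = (p y', z y')"
        then have "p y \<odot> z y = p y' \<odot> z y'" by simp
        then show "y = y'" using pz[OF y(1)] pz[OF y(2)] by metis
      qed
      then show ?thesis by (simp add: sum.reindex)
    qed
    also have "\<dots> \<le> (\<Sum>(x, y)\<in>p ` F2 \<times> z ` F2. h x y)"
      using fin h0 by (intro sum_mono2) auto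
    also have "\<dots> = (\<Sum>x\<in>p ` F2. \<Sum>y\<in>z ` F2. h x y)"
      by (rule sum.cartesian_product[symmetric])
    also have "\<dots> \<le> (\<Sum>x\<in>p ` F2. val \<alpha> x * opt_val (\<lambda>\<gamma>. avoiding_series A \<gamma> s) (act (Some \<alpha>) x))"
    proof (rule sum_mono)
      fix x
      have "(\<Sum>y\<in>z ` F2. weight \<gamma> s y) \<le> avoiding_series A \<gamma> s" for \<gamma>
        unfolding avoiding_series_def using fin X s
        by (intro finite_sum_le_infsum summable_weight avoiding_subset weight_nonneg) auto
      then show "(\<Sum>y\<in>z ` F2. h x y) \<le> val \<alpha> x * opt_val (\<lambda>\<gamma>. avoiding_series A \<gamma> s) (act (Some \<alpha>) x)"
        unfolding h_def sum_distrib_left[symmetric]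
        by (cases "act (Some \<alpha>) x") (auto intro!: mult_left_mono val_nonneg)
    qed
    also have "\<dots> = (\<Sum>x\<in>p ` F2. \<Sum>\<gamma>\<in>UNIV.
        (if act (Some \<alpha>) x = Some \<gamma> then val \<alpha> x else 0) * avoiding_series A \<gamma> s)"
    proof (rule sum.cong[OF HOL.refl])
      fix x
      show "val \<alpha> x * opt_val (\<lambda>\<gamma>. avoiding_series A \<gamma> s) (act (Some \<alpha>) x)
        = (\<Sum>\<gamma>\<in>UNIV. (if act (Some \<alpha>) x = Some \<gamma> then val \<alpha> x else 0) * avoiding_series A \<gamma> s)"
        by (cases "act (Some \<alpha>) x") (simp_all add: if_distrib[of "\<lambda>t. t * _"] cong: if_cong)
    qed
    also have "\<dots> = (\<Sum>\<gamma>\<in>UNIV. (\<Sum>x | x \<in> p ` F2 \<and> act (Some \<alpha>) x = Some \<gamma>. val \<alpha> x) * avoiding_series A \<gamma> s)"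
      by (subst sum.swap) (simp add: sum_distrib_right[symmetric] sum.inter_filter fin)
    also have "\<dots> \<le> (\<Sum>\<gamma>\<in>UNIV. first_prob A b \<alpha> \<gamma> * avoiding_series A \<gamma> s)"
      using fin X s
      by (intro sum_mono mult_right_mono sum_val_le_first_prob avoiding_series_nonneg) auto
    finally show ?thesis .
  qed
  ultimately show "(\<Sum>y\<in>F. weight \<alpha> s y)
      \<le> avoiding_series (insert b A) \<alpha> s + (\<Sum>\<gamma>\<in>UNIV. first_prob A b \<alpha> \<gamma> * avoiding_series A \<gamma> s)"
    by linarith
qed

section \<open>Asymptotics of the generating series\<close>

text \<open>
  The common normalization of all series. With it the ratios for \<open>A = {}\<close> sum to \<open>1\<close>, so that their
  limits cannot all vanish.
\<close>
definition total_series :: "real \<Rightarrow> real" where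
  "total_series s = (\<Sum>\<beta>\<in>UNIV. avoiding_series {} \<beta> s)"

lemma total_series_ge: "0 \<le> s \<Longrightarrow> s < 1 \<Longrightarrow> avoiding_series {} \<beta> s \<le> total_series s"
  unfolding total_series_def by (intro member_le_sum avoiding_series_nonneg) auto

lemma total_series_ge_geometric:
  assumes "0 \<le> s" "s < 1"
  shows "1 / (1 - s) \<le> total_series s"
proof -
  fix \<beta> :: 's
  have "(\<Sum>n. s ^ n) \<le> avoiding_series {} \<beta> s"
    using assms avoiding_series_empty_ge by (intro suminf_le_const) auto
  then show ?thesis using total_series_ge[of s \<beta>] suminf_geometric[of s] assms by simp
qed

lemma total_series_pos: "0 \<le> s \<Longrightarrow> s < 1 \<Longrightarrow> 0 < total_series s"
proof -
  assume s: "0 \<le> s" "s < 1"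
  then have "0 < 1 / (1 - s)" by simp
  then show ?thesis using total_series_ge_geometric[OF s] by (rule less_le_trans)
qed

definition series_ratio :: "'a set \<Rightarrow> 's \<Rightarrow> real \<Rightarrow> real" where
  "series_ratio A \<beta> s = avoiding_series A \<beta> s / total_series s"

lemma eventually_unit: "\<forall>\<^sub>F s in at_left 1. 0 \<le> s \<and> s < (1::real)"
  using eventually_at_left_real[of 0 1] by (rule eventually_mono) auto

lemma series_ratio_bounds: "0 \<le> s \<Longrightarrow> s < 1 \<Longrightarrow> 0 \<le> series_ratio A \<beta> s \<and> series_ratio A \<beta> s \<le> 1"
  using total_series_pos[of s] avoiding_series_nonneg[of s A \<beta>] avoiding_series_le[of s A \<beta>] total_series_ge[of s \<beta>]
  by (simp add: series_ratio_def)

lemma series_ratio_recurrence: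
  assumes "0 \<le> s" "s < 1"
  shows "series_ratio A \<alpha> s \<le> series_ratio (insert b A) \<alpha> s + (\<Sum>\<gamma>\<in>UNIV. first_prob A b \<alpha> \<gamma> * series_ratio A \<gamma> s)"
  using divide_right_mono[OF avoiding_series_recurrence[OF assms, of A \<alpha> b], of "total_series s"] total_series_pos[OF assms]
  by (simp add: series_ratio_def add_divide_distrib sum_divide_distrib)

text \<open>
  What is left of the recurrence in the limit, once the traces that avoid a further letter have
  become negligible.
\<close>
definition subharmonic :: "'a set \<Rightarrow> ('s \<Rightarrow> real) \<Rightarrow> bool" where
  "subharmonic A w \<longleftrightarrow> (\<forall>\<beta>. 0 \<le> w \<beta>) \<and>
    (\<forall>b. b \<notin> A \<longrightarrow> (\<forall>\<beta>. w \<beta> \<le> (\<Sum>\<gamma>\<in>UNIV. first_prob A b \<beta> \<gamma> * w \<gamma>)))"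

text \<open>
  The ratios range over a compact cube, so convergence can be tested on cluster points, and the
  recurrence makes every cluster point subharmonic.
\<close>
lemma series_ratio_tendsto_by_cluster_points:
  assumes small: "\<And>b \<beta>. b \<notin> A \<Longrightarrow> (series_ratio (insert b A) \<beta> \<longlongrightarrow> 0) (at_left 1)"
    and unique: "\<And>w. subharmonic A w \<Longrightarrow> (A = {} \<Longrightarrow> (\<Sum>\<beta>\<in>UNIV. w \<beta>) = 1) \<Longrightarrow> w \<alpha> = L"
  shows "(series_ratio A \<alpha> \<longlongrightarrow> L) (at_left 1)"
proof (rule ccontr)
  assume "\<not> (series_ratio A \<alpha> \<longlongrightarrow> L) (at_left 1)"
  then obtain e where e: "0 < e" "\<not> (\<forall>\<^sub>F s in at_left 1. dist (series_ratio A \<alpha> s) L < e)"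
    unfolding tendsto_iff by blast
  define F where "F = inf (at_left (1::real)) (principal {s. e \<le> dist (series_ratio A \<alpha> s) L})"
  have "F \<noteq> bot"
    using e(2) unfolding F_def trivial_limit_def eventually_inf_principal by (auto simp: not_le)
  have "F \<le> at_left 1" by (simp add: F_def)
  define v where "v s = (\<chi> \<beta>. series_ratio A \<beta> s)" for s
  have "\<forall>\<^sub>F s in F. 0 \<le> s \<and> s < 1"
    using eventually_unit \<open>F \<le> at_left 1\<close> by (rule filter_leD[rotated])
  then have "\<forall>\<^sub>F s in F. \<forall>i. 0 \<le> v s $ i \<and> v s $ i \<le> 1"
    by (rule eventually_mono) (simp add: v_def series_ratio_bounds)
  then obtain G w where G: "G \<le> F" "G \<noteq> bot" "(v \<longlongrightarrow> w) G"
    using bounded_vector_cluster_point \<open>F \<noteq> bot\<close> by blast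
  have lim: "(series_ratio A \<beta> \<longlongrightarrow> w $ \<beta>) G" for \<beta>
    using tendsto_vec_nth[OF G(3), of \<beta>] by (simp add: v_def)
  have G1: "G \<le> at_left 1" using G(1) \<open>F \<le> at_left 1\<close> by simp
  have unit: "\<forall>\<^sub>F s in G. 0 \<le> s \<and> s < 1"
    using eventually_unit G1 by (rule filter_leD[rotated])
  have "subharmonic A (($) w)"
    unfolding subharmonic_def
  proof (intro conjI allI impI)
    fix \<beta>
    show "0 \<le> w $ \<beta>"
      by (rule tendsto_lowerbound[OF lim _ G(2)])
        (use unit series_ratio_bounds in \<open>auto elim: eventually_mono\<close>)
    fix b assume "b \<notin> A"
    have "(series_ratio (insert b A) \<beta> \<longlongrightarrow> 0) G"
      using tendsto_mono[OF G1 small[OF \<open>b \<notin> A\<close>]] .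
    then have "((\<lambda>s. series_ratio (insert b A) \<beta> s + (\<Sum>\<gamma>\<in>UNIV. first_prob A b \<beta> \<gamma> * series_ratio A \<gamma> s))
        \<longlongrightarrow> 0 + (\<Sum>\<gamma>\<in>UNIV. first_prob A b \<beta> \<gamma> * w $ \<gamma>)) G"
      by (intro tendsto_intros lim)
    moreover have "\<forall>\<^sub>F s in G. series_ratio A \<beta> s
        \<le> series_ratio (insert b A) \<beta> s + (\<Sum>\<gamma>\<in>UNIV. first_prob A b \<beta> \<gamma> * series_ratio A \<gamma> s)"
      by (rule eventually_mono[OF unit]) (simp add: series_ratio_recurrence)
    ultimately show "w $ \<beta> \<le> (\<Sum>\<gamma>\<in>UNIV. first_prob A b \<beta> \<gamma> * w $ \<gamma>)"
      using tendsto_le[OF G(2) _ lim[of \<beta>]] by fastforce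
  qed
  moreover have "(\<Sum>\<beta>\<in>UNIV. w $ \<beta>) = 1" if "A = {}"
  proof (rule tendsto_unique[OF G(2)])
    show "((\<lambda>s. \<Sum>\<beta>\<in>UNIV. series_ratio A \<beta> s) \<longlongrightarrow> (\<Sum>\<beta>\<in>UNIV. w $ \<beta>)) G"
      by (intro tendsto_intros lim)
    have "(\<Sum>\<beta>\<in>UNIV. series_ratio A \<beta> s) = 1" if "0 \<le> s \<and> s < 1" for s
      using total_series_pos[of s] that \<open>A = {}\<close>
      by (simp add: series_ratio_def sum_divide_distrib[symmetric] total_series_def)
    then show "((\<lambda>s. \<Sum>\<beta>\<in>UNIV. series_ratio A \<beta> s) \<longlongrightarrow> 1) G"
      using unit by (intro tendsto_eventually) (auto elim: eventually_mono)
  qed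
  ultimately have "w $ \<alpha> = L" by (rule unique)
  then have "((\<lambda>s. dist (series_ratio A \<alpha> s) L) \<longlongrightarrow> 0) G"
    using tendsto_dist[OF lim[of \<alpha>] tendsto_const[of L]] by simp
  moreover have "\<forall>\<^sub>F s in G. e \<le> dist (series_ratio A \<alpha> s) L"
    using filter_leD[OF G(1), of "\<lambda>s. e \<le> dist (series_ratio A \<alpha> s) L"]
    by (simp add: F_def eventually_inf_principal)
  ultimately have "e \<le> 0" using G(2) by (intro tendsto_lowerbound)
  then show False using e by simp
qed

text \<open>
  Maximum principle: \<open>w \<alpha>\<close> is at most the average of \<open>w\<close> under transition probabilities that sum
  to at most \<open>1\<close>. If they sum to less, or if a smaller value of \<open>w\<close> gets positive weight, then
  this average is smaller than the maximum.
\<close>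
lemma subharmonic_maximum:
  assumes w: "subharmonic A w" and max: "\<And>\<gamma>. w \<gamma> \<le> w \<alpha>" and pos: "0 < w \<alpha>"
    and b: "b \<notin> A" and x: "x \<in> first_ideals b" "act (Some \<alpha>) x = Some \<beta>"
  shows "x \<in> avoiding A" "w \<beta> = w \<alpha>"
proof -
  let ?P = "first_prob A b \<alpha>"
  have xM: "x \<in> M" using x first_ideals_subset by blast
  have valx: "0 < val \<alpha> x" using val_pos_iff[OF xM] x by simp
  have sub: "w \<alpha> \<le> (\<Sum>\<gamma>\<in>UNIV. ?P \<gamma> * w \<gamma>)" using w b by (simp add: subharmonic_def)
  also have "\<dots> \<le> (\<Sum>\<gamma>\<in>UNIV. ?P \<gamma> * w \<alpha>)"
    using max by (intro sum_mono mult_left_mono first_prob_nonneg)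
  finally have le: "w \<alpha> \<le> (\<Sum>\<gamma>\<in>UNIV. ?P \<gamma>) * w \<alpha>" by (simp add: sum_distrib_right)
  show xA: "x \<in> avoiding A"
  proof (rule ccontr)
    assume "x \<notin> avoiding A"
    then have "(\<Sum>\<gamma>\<in>UNIV. ?P \<gamma>) + val \<alpha> x \<le> 1"
      using sum_first_prob_le[of "{x}" b A \<alpha>] x by simp
    then have "(\<Sum>\<gamma>\<in>UNIV. ?P \<gamma>) < 1" using valx by simp
    then show False using le pos by (metis linorder_not_le mult.left_neutral mult_strict_right_mono)
  qed
  show "w \<beta> = w \<alpha>"
  proof (rule ccontr)
    assume "w \<beta> \<noteq> w \<alpha>"
    then have "w \<beta> < w \<alpha>" using max[of \<beta>] by simp
    moreover have "val \<alpha> x \<le> ?P \<beta>"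
      using sum_val_le_first_prob[of "{x}" b A \<alpha> \<beta>] x xA by simp
    ultimately have "?P \<beta> * w \<beta> < ?P \<beta> * w \<alpha>" using valx by simp
    then have "(\<Sum>\<gamma>\<in>UNIV. ?P \<gamma> * w \<gamma>) < (\<Sum>\<gamma>\<in>UNIV. ?P \<gamma> * w \<alpha>)"
      using max by (intro sum_strict_mono_ex1) (auto intro!: mult_left_mono first_prob_nonneg)
    also have "\<dots> = (\<Sum>\<gamma>\<in>UNIV. ?P \<gamma>) * w \<alpha>" by (simp add: sum_distrib_right)
    also have "\<dots> \<le> 1 * w \<alpha>"
      using sum_first_prob_le[of "{}" b A \<alpha>] pos by (intro mult_right_mono) auto
    finally show False using sub by simp
  qed
qed

lemma act_prefix:
  assumes "x \<in> M" "y \<in> M" "act (Some \<alpha>) (x \<odot> y) \<noteq> None"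
  obtains \<beta> where "act (Some \<alpha>) x = Some \<beta>" "act (Some \<beta>) y = act (Some \<alpha>) (x \<odot> y)"
  using assms act_None by (cases "act (Some \<alpha>) x") (auto simp: act_mult)

end

locale irreducible_markov_system = markov_system I act \<nu>
  for I :: "('a::finite \<times> 'a) set"
    and act :: "'s::finite option \<Rightarrow> 'a list set \<Rightarrow> 's option"
    and \<nu> :: "'s \<Rightarrow> (nat \<Rightarrow> 'a set) measure" +
  assumes irreducible: "irreducible_system I act"
begin

lemma letter_reachable:
  obtains u where "u \<in> M" "act (Some \<alpha>) (u \<odot> trace_class I [a]) \<noteq> None"
  using irreducible unfolding irreducible_system_def by blast

text \<open>
  Let \<open>a \<in> A\<close> and \<open>b \<notin> A\<close> be dependent. Were \<open>w\<close> positive somewhere, then in every execution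
  from a state of maximal value the part below the first \<open>b\<close> would avoid \<open>A\<close> and end in a state of
  maximal value again; hence no occurrence of \<open>b\<close> would ever have an \<open>a\<close> below it. But an
  execution that contains \<open>a\<close> exists and can be continued until a \<open>b\<close> occurs, and this \<open>b\<close> has the
  \<open>a\<close> below it.
\<close>
lemma subharmonic_zero:
  assumes w: "subharmonic A w" and A: "A \<noteq> {}" "A \<noteq> UNIV"
  shows "w \<alpha> = 0"
proof (rule ccontr)
  assume "w \<alpha> \<noteq> 0"
  then have "0 < w \<alpha>" using w by (simp add: subharmonic_def order_less_le)
  define R where "R = Max (range w)"
  have max: "w \<gamma> \<le> R" for \<gamma> by (simp add: R_def)
  then have R: "0 < R" using \<open>0 < w \<alpha>\<close> less_le_trans by blast
  \<comment> \<open>the dependence graph is connected, so some edge leaves \<open>A\<close>\<close>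
  obtain a0 b0 where a0b0: "a0 \<in> A" "b0 \<notin> A" using A by auto
  have "(a0, b0) \<in> (- I)\<^sup>*"
    using irreducible by (simp add: irreducible_system_def irreducible_monoid_def)
  then obtain a b where ab: "(a, b) \<in> - I" "a \<in> A" "b \<notin> A"
    using a0b0 by (rule rtrancl_crosses_boundary)
  have step: "p \<in> avoiding A \<and> w \<delta> = R"
    if "w \<gamma> = R" "p \<in> first_ideals b" "act (Some \<gamma>) p = Some \<delta>" for \<gamma> \<delta> p
    using subharmonic_maximum[OF w, of \<gamma> b p \<delta>] max R that ab by auto
  \<comment> \<open>induction on the number of occurrences of \<open>b\<close> in the execution \<open>y\<close>\<close>
  have no: False if "w \<gamma> = R" "y \<in> M" "act (Some \<gamma>) y \<noteq> None" "a \<in> letters y" for y \<gamma>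
    using that
  proof (induction "parikh y b" arbitrary: y \<gamma> rule: less_induct)
    case less
    show False
    proof (cases "b \<in> letters y")
      case True
      obtain p z where pz: "p \<in> first_ideals b" "z \<in> M" "y = p \<odot> z"
        using first_ideal_exists less.prems(2) True by blast
      have pM: "p \<in> M" using pz first_ideals_subset by blast
      obtain \<delta> where \<delta>: "act (Some \<gamma>) p = Some \<delta>" "act (Some \<delta>) z = act (Some \<gamma>) y"
        using act_prefix[OF pM pz(2)] less.prems pz by metis
      have p: "p \<in> avoiding A" "w \<delta> = R" using step less.prems(1) pz(1) \<delta>(1) by auto
      then have "a \<in> letters z"
        using less.prems(4) ab letters_mult[OF pM pz(2)] pz(3) by (auto simp: avoiding_def)
      moreover have "0 < parikh p b" using pz(1) pM by (simp add: parikh_pos_iff first_ideals_def)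
      then have "parikh z b < parikh y b" using parikh_mult[OF pM pz(2)] pz(3) by simp
      ultimately show False using less.hyps[of z \<delta>] p \<delta> pz less.prems by metis
    next
      case False
      obtain \<delta> where \<delta>: "act (Some \<gamma>) y = Some \<delta>" using less.prems by auto
      obtain u where u: "u \<in> M" "act (Some \<delta>) (u \<odot> trace_class I [b]) \<noteq> None"
        by (rule letter_reachable)
      define y' where "y' = y \<odot> (u \<odot> trace_class I [b])"
      have y': "y' \<in> M" "b \<in> letters y'" "act (Some \<gamma>) y' \<noteq> None"
        using less.prems u \<delta> by (simp_all add: y'_def letters_mult act_mult)
      obtain p z where pz: "p \<in> first_ideals b" "z \<in> M" "y' = p \<odot> z"
        using first_ideal_exists y' by blast
      have pM: "p \<in> M" using pz first_ideals_subset by blast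
      obtain \<epsilon> where "act (Some \<gamma>) p = Some \<epsilon>"
        using act_prefix[OF pM pz(2)] y' pz by metis
      then have pA: "p \<in> avoiding A" using step less.prems(1) pz(1) by auto
      have "trace_le I p y'" "trace_le I y y'"
        using pz u by (auto simp: trace_le_def y'_def)
      moreover obtain wp wy wy' where words:
        "p = trace_class I wp" "y = trace_class I wy" "y' = trace_class I wy'"
        using pM less.prems(2) y'(1) by (metis traceE)
      ultimately have "word_le I wp wy'" "word_le I wy wy'" by (simp_all add: trace_le_iff)
      moreover have "b \<in> set wp" "a \<notin> set wp" "a \<in> set wy" "b \<notin> set wy"
        using pz(1) pA ab less.prems(4) False words by (auto simp: first_ideals_def avoiding_def)
      ultimately show False using first_letters_conflict ab(1) by blast
    qed
  qed
  have "R \<in> range w" unfolding R_def by (rule Max_in) auto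
  then obtain \<gamma> where "w \<gamma> = R" by auto
  moreover obtain u where "u \<in> M" "act (Some \<gamma>) (u \<odot> trace_class I [a]) \<noteq> None"
    by (rule letter_reachable)
  ultimately show False using no[of \<gamma> "u \<odot> trace_class I [a]"] by (simp add: letters_mult)
qed

lemma letter_first_ideal: "trace_class I [a] \<in> first_ideals a"
proof -
  have *: "trace_class I v = trace_class I [a]" if "word_le I v [a]" "a \<in> set v" for v
    unfolding trace_class_eq_iff
  proof (rule word_le_antisym[OF that(1)])
    show "word_le I [a] v"
    proof (rule word_le_if_count_le[OF word_le_refl that(1)])
      show "count_list [a] c \<le> count_list v c" for c
        using that(2) count_list_0_iff[of v c] by (auto simp: Suc_le_eq)
    qed
  qed
  show ?thesis
    unfolding first_ideals_def
  proof (intro CollectI conjI ballI impI)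
    fix y assume y: "y \<in> M" "trace_le I y (trace_class I [a])" "a \<in> letters y"
    obtain v where v: "y = trace_class I v" using y(1) by (rule traceE)
    show "y = trace_class I [a]" using y(2,3) unfolding v by (intro *) (simp_all add: trace_le_iff)
  qed simp_all
qed

text \<open>
  A single letter is its own first ideal, so the set of states of maximal value is closed under
  letters, and by transitivity it is everything.
\<close>
lemma subharmonic_const:
  assumes w: "subharmonic {} w"
  shows "w \<alpha> = w \<beta>"
proof -
  define R where "R = Max (range w)"
  have max: "w \<gamma> \<le> R" for \<gamma> by (simp add: R_def)
  have "R \<in> range w" unfolding R_def by (rule Max_in) auto
  then obtain \<gamma> where \<gamma>: "w \<gamma> = R" by auto
  have step: "w \<epsilon> = R" if "w \<delta> = R" "act (Some \<delta>) (trace_class I [a]) = Some \<epsilon>" for a \<delta> \<epsilon>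
  proof (cases "0 < R")
    case True
    then show ?thesis
      using subharmonic_maximum(2)[OF w, of \<delta> a "trace_class I [a]" \<epsilon>] letter_first_ideal max that
      by auto
  next
    case False
    moreover have "0 \<le> w \<epsilon>" using w by (simp add: subharmonic_def)
    ultimately show ?thesis using max[of \<epsilon>] by linarith
  qed
  have "w \<epsilon> = R" if "w \<delta> = R" "act (Some \<delta>) (trace_class I u) = Some \<epsilon>" for u \<delta> \<epsilon>
    using that
  proof (induction u arbitrary: \<delta>)
    case Nil
    then show ?case by (simp add: act_one)
  next
    case (Cons a u)
    have eq: "trace_class I (a # u) = trace_class I [a] \<odot> trace_class I u"
      by (simp add: trace_class_mult)
    obtain \<zeta> where "act (Some \<delta>) (trace_class I [a]) = Some \<zeta>"
      "act (Some \<zeta>) (trace_class I u) = Some \<epsilon>"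
      using act_prefix[of "trace_class I [a]" "trace_class I u" \<delta>] Cons.prems(2)
      unfolding eq by auto
    then show ?case using Cons step by blast
  qed
  moreover have "\<exists>u. act (Some \<gamma>) (trace_class I u) = Some \<epsilon>" for \<epsilon>
  proof -
    obtain x where "x \<in> M" "act (Some \<gamma>) x = Some \<epsilon>"
      using irreducible unfolding irreducible_system_def transitive_system_def traces_between_def
      by blast
    then show ?thesis by (auto elim: traceE)
  qed
  ultimately show ?thesis using \<gamma> by metis
qed

text \<open>
  Descending induction on \<open>A\<close>: the traces that avoid \<open>A\<close> and a further letter are negligible by
  induction hypothesis, so cluster points of the ratios for \<open>A\<close> are subharmonic and hence zero.
\<close>
lemma series_ratio_tendsto_0:
  assumes "A \<noteq> {}"
  shows "(series_ratio A \<alpha> \<longlongrightarrow> 0) (at_left 1)"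
  using assms
proof (induction "card (- A)" arbitrary: A \<alpha> rule: less_induct)
  case less
  show ?case
  proof (cases "A = UNIV")
    case True
    have "((\<lambda>s. 1 - s) \<longlongrightarrow> 1 - 1) (at_left (1::real))" by (intro tendsto_intros)
    then have "((\<lambda>s. 1 - s) \<longlongrightarrow> 0) (at_left (1::real))" by simp
    moreover have "\<forall>\<^sub>F s in at_left 1. 0 \<le> series_ratio A \<alpha> s"
      using eventually_unit series_ratio_bounds by (auto elim: eventually_mono)
    moreover have "\<forall>\<^sub>F s in at_left 1. series_ratio A \<alpha> s \<le> 1 - s"
    proof (rule eventually_mono[OF eventually_unit])
      fix s :: real assume s: "0 \<le> s \<and> s < 1"
      then have "1 / total_series s \<le> 1 - s"
        using total_series_ge_geometric[of s] total_series_pos[of s] by (simp add: field_simps)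
      then show "series_ratio A \<alpha> s \<le> 1 - s" by (simp add: series_ratio_def True avoiding_series_UNIV)
    qed
    ultimately show ?thesis using tendsto_const by (rule tendsto_sandwich[rotated 2, rotated])
  next
    case False
    show ?thesis
    proof (rule series_ratio_tendsto_by_cluster_points)
      fix b \<beta> assume "b \<notin> A"
      then have "card (- insert b A) < card (- A)" by (intro psubset_card_mono) auto
      then show "(series_ratio (insert b A) \<beta> \<longlongrightarrow> 0) (at_left 1)" using less.hyps by blast
    next
      show "w \<alpha> = 0" if "subharmonic A w" for w
        using subharmonic_zero[OF that less.prems False] .
    qed
  qed
qed

lemma series_ratio_tendsto: "(series_ratio {} \<alpha> \<longlongrightarrow> 1 / card (UNIV :: 's set)) (at_left 1)"
proof (rule series_ratio_tendsto_by_cluster_points)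
  fix w :: "'s \<Rightarrow> real" assume w: "subharmonic {} w" "{} = {} \<Longrightarrow> (\<Sum>\<beta>\<in>UNIV. w \<beta>) = 1"
  have "(\<Sum>\<beta>\<in>UNIV. w \<beta>) = (\<Sum>\<beta>\<in>(UNIV :: 's set). w \<alpha>)"
    by (rule sum.cong) (use subharmonic_const[OF w(1)] in auto)
  then have "real (card (UNIV :: 's set)) * w \<alpha> = 1" using w(2) by simp
  then show "w \<alpha> = 1 / card (UNIV :: 's set)" by (metis nonzero_mult_div_cancel_left mult_zero_left zero_neq_one)
qed (simp add: series_ratio_tendsto_0)

text \<open>The limits of the ratios do not depend on the state and are not zero.\<close>
lemma avoiding_series_quotient_tendsto: "((\<lambda>s. avoiding_series {} \<beta> s / avoiding_series {} \<alpha> s) \<longlongrightarrow> 1) (at_left 1)"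
proof -
  have "((\<lambda>s. series_ratio {} \<beta> s / series_ratio {} \<alpha> s) \<longlongrightarrow>
      (1 / card (UNIV :: 's set)) / (1 / card (UNIV :: 's set))) (at_left 1)"
    by (intro tendsto_divide series_ratio_tendsto) simp
  moreover have "\<forall>\<^sub>F s in at_left 1. series_ratio {} \<beta> s / series_ratio {} \<alpha> s = avoiding_series {} \<beta> s / avoiding_series {} \<alpha> s"
    using eventually_unit
  proof (rule eventually_mono)
    fix s :: real assume "0 \<le> s \<and> s < 1"
    then show "series_ratio {} \<beta> s / series_ratio {} \<alpha> s = avoiding_series {} \<beta> s / avoiding_series {} \<alpha> s"
      using total_series_pos[of s] by (simp add: series_ratio_def)
  qed
  ultimately show ?thesis using tendsto_cong by fastforce
qed

end

section \<open>Point measures and continuous functions\<close>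

lemma emeasure_point_measure_infsum:
  assumes "\<And>x. x \<in> D \<Longrightarrow> 0 \<le> h x" "h summable_on D" "X \<subseteq> D"
  shows "emeasure (point_measure D (\<lambda>x. ennreal (h x))) X = ennreal (infsum h X)"
proof -
  have "h summable_on X" using summable_on_subset_banach assms(2,3) .
  moreover have "h summable_on X \<longleftrightarrow> (\<lambda>x. norm (h x)) summable_on X"
    using assms(1,3) by (intro summable_on_cong) auto
  ultimately have abs: "Infinite_Set_Sum.abs_summable_on h X"
    by (simp add: abs_summable_equivalent[symmetric])
  have "emeasure (point_measure D (\<lambda>x. ennreal (h x))) X
      = (\<integral>\<^sup>+x. ennreal (h x) * indicator X x \<partial>count_space D)"
    unfolding point_measure_def using assms(3) by (subst emeasure_density) auto
  also have "\<dots> = (\<integral>\<^sup>+x. ennreal (h x) \<partial>count_space X)"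
    unfolding nn_integral_count_space_indicator[of D, simplified]
      nn_integral_count_space_indicator[of X, simplified]
    using assms(3) by (intro nn_integral_cong) (auto simp: indicator_def)
  also have "\<dots> = ennreal (infsetsum h X)"
    using assms(1,3) abs by (intro nn_integral_conv_infsetsum) auto
  also have "\<dots> = ennreal (infsum h X)"
    using infsetsum_infsum[OF abs] by simp
  finally show ?thesis .
qed

context trace_alphabet begin

lemma borel_measurable_continuous_map:
  assumes "continuous_map T euclideanreal g" "sets N = sets (borel_of T)"
  shows "g \<in> borel_measurable N"
proof -
  have "g \<in> borel_measurable (borel_of T)"
  proof (rule borel_measurableI)
    fix S :: "real set" assume "open S"
    then have "openin T {x \<in> topspace T. g x \<in> S}"
      using assms(1) by (simp add: continuous_map_def)
    moreover have "g -` S \<inter> space (borel_of T) = {x \<in> topspace T. g x \<in> S}"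
      by (auto simp: space_borel_of)
    ultimately show "g -` S \<inter> space (borel_of T) \<in> sets (borel_of T)"
      by (simp add: sets_borel_of_open)
  qed
  then show ?thesis using measurable_cong_sets[OF assms(2) HOL.refl] by blast
qed

section \<open>Weak convergence from convergence on cones\<close>

definition trunc :: "nat \<Rightarrow> (nat \<Rightarrow> 'a set) \<Rightarrow> nat \<Rightarrow> 'a set" where
  "trunc n \<xi> = (\<lambda>i. if i < n then \<xi> i else {})"

definition cylinder :: "nat \<Rightarrow> (nat \<Rightarrow> 'a set) \<Rightarrow> (nat \<Rightarrow> 'a set) set" where
  "cylinder n \<kappa> = {\<xi> \<in> gen_traces I. trunc n \<xi> = \<kappa>}"

definition prefix_cone :: "'a list set \<Rightarrow> (nat \<Rightarrow> 'a set) set" where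
  "prefix_cone x = {\<xi> \<in> gen_traces I. trace_le_inf I x \<xi>}"

lemma trunc_gen: "\<xi> \<in> gen_traces I \<Longrightarrow> trunc n \<xi> \<in> gen_traces I"
  by (auto simp: gen_traces_def trunc_def clique_def clique_arrow_def)

lemma trunc_eq_iff: "trunc n \<xi> = trunc n \<xi>' \<longleftrightarrow> (\<forall>i<n. \<xi> i = \<xi>' i)"
  unfolding trunc_def fun_eq_iff by auto

lemma trunc_trunc [simp]: "trunc n (trunc n \<xi>) = trunc n \<xi>"
  by (simp add: trunc_def fun_eq_iff)

lemma head_word_trunc [simp]: "head_word (trunc n \<xi>) n = head_word \<xi> n"
  by (rule head_word_cong) (simp add: trunc_def)

lemma finite_truncations: "finite (trunc n ` gen_traces I)"
proof (rule finite_subset)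
  show "trunc n ` gen_traces I \<subseteq>
      {f. \<forall>i. (i \<in> {..<n} \<longrightarrow> f i \<in> UNIV) \<and> (i \<notin> {..<n} \<longrightarrow> f i = {})}"
    by (auto simp: trunc_def)
qed (rule finite_set_of_finite_funs; simp)

lemma openin_trunc: "openin (gen_trace_topology I) {\<xi> \<in> gen_traces I. trunc n \<xi> \<in> S}"
proof (rule openin_if_finitely_determined)
  fix \<xi> assume \<xi>: "\<xi> \<in> {\<xi> \<in> gen_traces I. trunc n \<xi> \<in> S}"
  have "trunc n \<xi>' \<in> S" if "\<forall>i<n. \<xi>' i = \<xi> i" for \<xi>'
  proof -
    have "trunc n \<xi>' = trunc n \<xi>" using that by (simp add: trunc_eq_iff)
    then show ?thesis using \<xi> by simp
  qed
  then show "\<exists>n'. \<forall>\<xi>'\<in>gen_traces I. (\<forall>i<n'. \<xi>' i = \<xi> i) \<longrightarrow>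
      \<xi>' \<in> {\<xi> \<in> gen_traces I. trunc n \<xi> \<in> S}"
    by blast
qed auto

lemma sets_cylinder: "cylinder n \<kappa> \<in> sets (borel_of (gen_trace_topology I))"
  using openin_trunc[of n "{\<kappa>}"] by (intro sets_borel_of_open) (simp add: cylinder_def)

lemma sets_cone: "x \<in> M \<Longrightarrow> prefix_cone x \<in> sets (borel_of (gen_trace_topology I))"
  unfolding prefix_cone_def by (intro sets_borel_of_open openin_above)

lemma cone_head_eq:
  assumes "\<kappa> \<in> gen_traces I"
  shows "prefix_cone (head_trace I \<kappa> n) =
    (\<Union>\<kappa>'\<in>{\<kappa>' \<in> trunc n ` gen_traces I. word_le I (head_word \<kappa> n) (head_word \<kappa>' n)}. cylinder n \<kappa>')"
proof -
  have "trace_le_inf I (head_trace I \<kappa> n) \<xi> \<longleftrightarrow> word_le I (head_word \<kappa> n) (head_word (trunc n \<xi>) n)"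
    if "\<xi> \<in> gen_traces I" for \<xi>
    using trace_le_inf_head[OF assms that] by simp
  then show ?thesis by (auto simp: prefix_cone_def cylinder_def simp del: head_word_trunc)
qed

text \<open>
  A cone whose apex has \<open>n\<close> levels is a disjoint union of cylinders of depth \<open>n\<close>, of which all
  but one have a strictly longer apex. So the measures of the finitely many cylinders of depth
  \<open>n\<close> are determined by those of the cones, by descending induction on the length.
\<close>
lemma measure_cylinder_tendsto:
  fixes \<mu> :: "'c \<Rightarrow> (nat \<Rightarrow> 'a set) measure"
  assumes prob: "\<forall>\<^sub>F s in F. prob_space (\<mu> s)" "prob_space \<mu>'"
    and sets: "\<And>s. sets (\<mu> s) = sets (borel_of (gen_trace_topology I))"
      "sets \<mu>' = sets (borel_of (gen_trace_topology I))"
    and cones: "\<And>x. x \<in> M \<Longrightarrow> ((\<lambda>s. measure (\<mu> s) (prefix_cone x)) \<longlongrightarrow> measure \<mu>' (prefix_cone x)) F"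
    and \<kappa>: "\<kappa> \<in> trunc n ` gen_traces I"
  shows "((\<lambda>s. measure (\<mu> s) (cylinder n \<kappa>)) \<longlongrightarrow> measure \<mu>' (cylinder n \<kappa>)) F"
proof -
  define L where "L = Max ((\<lambda>\<kappa>. length (head_word \<kappa> n)) ` trunc n ` gen_traces I)"
  have L: "length (head_word \<kappa> n) \<le> L" if "\<kappa> \<in> trunc n ` gen_traces I" for \<kappa>
    using that finite_truncations unfolding L_def by (intro Max_ge) auto
  show ?thesis
    using \<kappa>
  proof (induction "L - length (head_word \<kappa> n)" arbitrary: \<kappa> rule: less_induct)
    case less
    have g: "\<kappa> \<in> gen_traces I" using less.prems trunc_gen by auto
    define S where "S = {\<kappa>' \<in> trunc n ` gen_traces I. word_le I (head_word \<kappa> n) (head_word \<kappa>' n)}"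
    have S: "finite S" "\<kappa> \<in> S" using finite_truncations less.prems by (auto simp: S_def)
    have split: "measure N (cylinder n \<kappa>) =
        measure N (prefix_cone (head_trace I \<kappa> n)) - (\<Sum>\<kappa>'\<in>S - {\<kappa>}. measure N (cylinder n \<kappa>'))"
      if N: "prob_space N" "sets N = sets (borel_of (gen_trace_topology I))" for N
    proof -
      interpret prob_space N by (rule N)
      have "measure N (prefix_cone (head_trace I \<kappa> n)) = (\<Sum>\<kappa>'\<in>S. measure N (cylinder n \<kappa>'))"
        unfolding cone_head_eq[OF g] S_def[symmetric]
      proof (rule finite_measure_finite_Union)
        show "cylinder n ` S \<subseteq> events" using sets_cylinder N(2) by auto
        show "disjoint_family_on (cylinder n) S"
          by (auto simp: disjoint_family_on_def cylinder_def)
      qed (rule S)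
      then show ?thesis by (simp add: sum.remove[OF S])
    qed
    have longer: "length (head_word \<kappa> n) < length (head_word \<kappa>' n)" if "\<kappa>' \<in> S - {\<kappa>}" for \<kappa>'
    proof -
      have \<kappa>': "\<kappa>' \<in> trunc n ` gen_traces I" "\<kappa>' \<noteq> \<kappa>" "word_le I (head_word \<kappa> n) (head_word \<kappa>' n)"
        using that by (auto simp: S_def)
      then obtain z where z: "(head_word \<kappa>' n, head_word \<kappa> n @ z) \<in> trace_cong I"
        using word_le_iff_factor by blast
      have "z \<noteq> []"
      proof
        assume "z = []"
        then have "(head_word \<kappa>' n, head_word \<kappa> n) \<in> trace_cong I" using z by simp
        then have "\<kappa>' i = \<kappa> i" if "i < n" for i
          using head_word_inj g \<kappa>'(1) trunc_gen that by blast
        then have "trunc n \<kappa>' = trunc n \<kappa>" by (simp add: trunc_eq_iff)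
        then show False using \<kappa>'(1,2) less.prems by auto
      qed
      moreover have "length (head_word \<kappa>' n) = length (head_word \<kappa> n @ z)"
        using z by (metis trace_class_eq_iff trace_length_class)
      ultimately show ?thesis by simp
    qed
    have "((\<lambda>s. measure (\<mu> s) (prefix_cone (head_trace I \<kappa> n)) -
        (\<Sum>\<kappa>'\<in>S - {\<kappa>}. measure (\<mu> s) (cylinder n \<kappa>'))) \<longlongrightarrow>
      measure \<mu>' (prefix_cone (head_trace I \<kappa> n)) - (\<Sum>\<kappa>'\<in>S - {\<kappa>}. measure \<mu>' (cylinder n \<kappa>'))) F"
    proof (intro tendsto_diff tendsto_sum cones head_trace_carrier)
      fix \<kappa>' assume \<kappa>': "\<kappa>' \<in> S - {\<kappa>}"
      then have "\<kappa>' \<in> trunc n ` gen_traces I" by (auto simp: S_def)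
      with longer[OF \<kappa>'] L[of \<kappa>'] L[OF less.prems]
      show "((\<lambda>s. measure (\<mu> s) (cylinder n \<kappa>')) \<longlongrightarrow> measure \<mu>' (cylinder n \<kappa>')) F"
        by (intro less.hyps) auto
    qed
    moreover have "\<forall>\<^sub>F s in F. measure (\<mu> s) (prefix_cone (head_trace I \<kappa> n)) -
        (\<Sum>\<kappa>'\<in>S - {\<kappa>}. measure (\<mu> s) (cylinder n \<kappa>')) = measure (\<mu> s) (cylinder n \<kappa>)"
      by (rule eventually_mono[OF prob(1)]) (simp add: split sets)
    ultimately show ?case
      using split[OF prob(2) sets(2)] tendsto_cong by fastforce
  qed
qed

text \<open>
  Being a generalized trace is a condition on each pair of consecutive coordinates, and there are
  finitely many values \<open>c\<close> for the first one.
\<close>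
lemma closedin_gen_traces:
  "closedin (product_topology (\<lambda>_. discrete_topology {c. clique I c}) UNIV) (gen_traces I)"
    (is "closedin ?P _")
proof -
  have coord: "closedin ?P {\<xi> \<in> topspace ?P. \<xi> i \<in> A \<inter> {c. clique I c}}" for i and A :: "'a set set"
    by (rule closedin_continuous_map_preimage[OF continuous_map_product_projection]) auto
  define A where "A i c = {\<xi> \<in> topspace ?P. \<xi> i \<in> {c} \<inter> {c. clique I c}} \<inter>
    {\<xi> \<in> topspace ?P. \<xi> (Suc i) \<in> {d. clique_arrow I c d} \<inter> {c. clique I c}}" for i c
  have "closedin ?P (A i c)" for i c
    unfolding A_def by (intro closedin_Int coord)
  then have "closedin ?P (\<Inter>i. \<Union>c. A i c)"
    by (intro closedin_INT closedin_Union) auto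
  moreover have "gen_traces I = (\<Inter>i. \<Union>c. A i c)"
    by (auto simp: gen_traces_def A_def)
  ultimately show ?thesis by simp
qed

lemma compact_gen_trace_topology: "compact_space (gen_trace_topology I)"
proof -
  have "compact_space (product_topology (\<lambda>_::nat. discrete_topology {c. clique I c}) UNIV)"
    by (auto simp: compact_space_product_topology compact_space_discrete_topology)
  then show ?thesis
    unfolding gen_trace_topology_def
    using closedin_compact_space closedin_gen_traces compact_space_subtopology by blast
qed

lemma open_contains_cylinder:
  assumes "openin (gen_trace_topology I) U" "\<xi> \<in> U"
  obtains n where "cylinder n (trunc n \<xi>) \<subseteq> U"
proof -
  obtain V where V: "openin (product_topology (\<lambda>_. discrete_topology {c. clique I c}) UNIV) V"
    "U = V \<inter> gen_traces I"
    using assms(1) unfolding gen_trace_topology_def openin_subtopology by blast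
  then obtain W where W: "finite {i. W i \<noteq> {c. clique I c}}" "\<xi> \<in> PiE UNIV W" "PiE UNIV W \<subseteq> V"
    using assms(2) unfolding openin_product_topology_alt by force
  obtain n where n: "\<forall>i\<in>{i. W i \<noteq> {c. clique I c}}. i < n"
    using finite_nat_set_iff_bounded W(1) by blast
  have "\<xi>' \<in> U" if "\<xi>' \<in> cylinder n (trunc n \<xi>)" for \<xi>'
  proof -
    have \<xi>': "\<xi>' \<in> gen_traces I" "\<forall>i<n. \<xi>' i = \<xi> i"
      using that by (auto simp: cylinder_def trunc_eq_iff)
    have "\<xi>' i \<in> W i" for i
    proof (cases "i < n")
      case True
      then show ?thesis using \<xi>'(2) W(2) by auto
    next
      case False
      then have "W i = {c. clique I c}" using n by blast
      then show ?thesis using gen_traces_clique[OF \<xi>'(1)] by simp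
    qed
    then have "\<xi>' \<in> PiE UNIV W" by auto
    then show ?thesis using W(3) V(2) \<xi>'(1) by blast
  qed
  then show thesis using that by blast
qed

text \<open>
  By compactness, a continuous function is up to \<open>e\<close> determined by finitely many cliques, uniformly
  in the generalized trace.
\<close>
lemma uniform_truncation:
  assumes g: "continuous_map (gen_trace_topology I) euclideanreal g" and "0 < e"
  obtains n where "\<And>\<xi>. \<xi> \<in> gen_traces I \<Longrightarrow> \<bar>g \<xi> - g (trunc n \<xi>)\<bar> \<le> e"
proof -
  let ?T = "gen_trace_topology I"
  have "\<exists>n. cylinder n (trunc n \<xi>) \<subseteq> {\<xi>' \<in> topspace ?T. g \<xi>' \<in> ball (g \<xi>) (e / 2)}"
    if "\<xi> \<in> gen_traces I" for \<xi>
  proof -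
    have "openin ?T {\<xi>' \<in> topspace ?T. g \<xi>' \<in> ball (g \<xi>) (e / 2)}"
      by (rule openin_continuous_map_preimage[OF g]) simp
    then show ?thesis
      using open_contains_cylinder[of _ \<xi>] that \<open>0 < e\<close> by (metis (no_types, lifting)
          centre_in_ball half_gt_zero mem_Collect_eq topspace_gen)
  qed
  then have "\<exists>m. \<forall>\<xi>\<in>gen_traces I.
      cylinder (m \<xi>) (trunc (m \<xi>) \<xi>) \<subseteq> {\<xi>' \<in> topspace ?T. g \<xi>' \<in> ball (g \<xi>) (e / 2)}"
    by (intro bchoice ballI)
  then obtain m where m: "\<forall>\<xi>\<in>gen_traces I.
      cylinder (m \<xi>) (trunc (m \<xi>) \<xi>) \<subseteq> {\<xi>' \<in> topspace ?T. g \<xi>' \<in> ball (g \<xi>) (e / 2)}"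
    by blast
  let ?C = "\<lambda>\<xi>. cylinder (m \<xi>) (trunc (m \<xi>) \<xi>)"
  have "compactin ?T (topspace ?T)"
    using compact_gen_trace_topology by (simp add: compact_space_def)
  moreover have "openin ?T (?C \<xi>)" for \<xi>
    using openin_trunc[of "m \<xi>" "{trunc (m \<xi>) \<xi>}"] by (simp add: cylinder_def)
  moreover have "topspace ?T \<subseteq> \<Union> (?C ` gen_traces I)"
    by (auto simp: topspace_gen cylinder_def)
  ultimately obtain \<F> where \<F>: "finite \<F>" "\<F> \<subseteq> ?C ` gen_traces I" "topspace ?T \<subseteq> \<Union> \<F>"
    using compactinD[of ?T "topspace ?T" "?C ` gen_traces I"] by blast
  then obtain X where X: "X \<subseteq> gen_traces I" "finite X" "\<F> = ?C ` X"
    by (meson finite_subset_image)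
  define n where "n = Max (insert 0 (m ` X))"
  have n: "m \<xi> \<le> n" if "\<xi> \<in> X" for \<xi> using that X by (simp add: n_def)
  have "\<bar>g \<xi> - g (trunc n \<xi>)\<bar> \<le> e" if \<xi>: "\<xi> \<in> gen_traces I" for \<xi>
  proof -
    obtain \<zeta> where \<zeta>: "\<zeta> \<in> X" "\<xi> \<in> ?C \<zeta>"
      using \<F>(3) X(3) \<xi> by (auto simp: topspace_gen)
    have "trunc n \<xi> \<in> ?C \<zeta>"
      using \<zeta> n[OF \<zeta>(1)] trunc_gen[OF \<xi>]
      by (auto simp: cylinder_def trunc_eq_iff) (auto simp: trunc_def)
    then have "g \<xi> \<in> ball (g \<zeta>) (e / 2)" "g (trunc n \<xi>) \<in> ball (g \<zeta>) (e / 2)"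
      using m \<zeta> X(1) by blast+
    then show ?thesis unfolding mem_ball dist_real_def by linarith
  qed
  then show thesis using that by blast
qed

lemma integral_near_cylinder_sum:
  assumes N: "prob_space N" "sets N = sets (borel_of (gen_trace_topology I))"
    and g: "continuous_map (gen_trace_topology I) euclideanreal g"
      "bounded (g ` topspace (gen_trace_topology I))"
    and n: "\<And>\<xi>. \<xi> \<in> gen_traces I \<Longrightarrow> \<bar>g \<xi> - g (trunc n \<xi>)\<bar> \<le> e"
  shows "\<bar>integral\<^sup>L N g - (\<Sum>\<kappa>\<in>trunc n ` gen_traces I. g \<kappa> * measure N (cylinder n \<kappa>))\<bar> \<le> e"
proof -
  interpret prob_space N by (rule N)
  let ?K = "trunc n ` gen_traces I"
  have space: "space N = gen_traces I"
    using sets_eq_imp_space_eq[OF N(2)] by (simp add: space_borel_of topspace_gen)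
  obtain B where B: "\<And>\<xi>. \<xi> \<in> gen_traces I \<Longrightarrow> \<bar>g \<xi>\<bar> \<le> B"
    using g(2) by (auto simp: bounded_iff topspace_gen)
  have gint: "integrable N g"
    using borel_measurable_continuous_map[OF g(1) N(2)] B
    by (intro integrable_const_bound[of _ B]) (auto simp: space)
  define h where "h \<xi> = (\<Sum>\<kappa>\<in>?K. g \<kappa> * indicat_real (cylinder n \<kappa>) \<xi>)" for \<xi>
  have ev: "cylinder n \<kappa> \<in> events" for \<kappa> using sets_cylinder N(2) by simp
  have hint: "integrable N h"
    unfolding h_def using ev by (intro Bochner_Integration.integrable_sum integrable_mult_right) (simp add: emeasure_eq_measure)
  have "integral\<^sup>L N h = (\<Sum>\<kappa>\<in>?K. g \<kappa> * measure N (cylinder n \<kappa>))"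
    unfolding h_def using ev
    by (subst Bochner_Integration.integral_sum) (auto simp: emeasure_eq_measure)
  moreover have "h \<xi> = g (trunc n \<xi>)" if "\<xi> \<in> gen_traces I" for \<xi>
  proof -
    have "h \<xi> = (\<Sum>\<kappa>\<in>?K. if \<kappa> = trunc n \<xi> then g \<kappa> else 0)"
      unfolding h_def using that by (intro sum.cong) (auto simp: cylinder_def indicator_def)
    then show ?thesis using that finite_truncations by simp
  qed
  then have diff: "\<bar>g \<xi> - h \<xi>\<bar> \<le> e" if "\<xi> \<in> space N" for \<xi>
    using n that by (simp add: space)
  moreover have "integral\<^sup>L N g - integral\<^sup>L N h = (\<integral>\<xi>. g \<xi> - h \<xi> \<partial>N)"
    using gint hint by simp
  moreover have "(\<integral>\<xi>. g \<xi> - h \<xi> \<partial>N) \<le> e"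
    using gint hint diff by (intro integral_le_const) (auto simp: abs_le_iff)
  moreover have "- e \<le> (\<integral>\<xi>. g \<xi> - h \<xi> \<partial>N)"
  proof (intro integral_ge_const AE_I2)
    show "- e \<le> g \<xi> - h \<xi>" if "\<xi> \<in> space N" for \<xi> using diff[OF that] by linarith
  qed (use gint hint in simp)
  ultimately show ?thesis by (simp add: abs_le_iff)
qed

text \<open>
  Both integrals are approximated by the same finite sum over cylinders, with an error that does
  not depend on the measure.
\<close>
lemma weak_limit_if_cones_converge:
  fixes \<mu> :: "'c \<Rightarrow> (nat \<Rightarrow> 'a set) measure"
  assumes prob: "\<forall>\<^sub>F s in F. prob_space (\<mu> s)" "prob_space \<mu>'"
    and sets: "\<And>s. sets (\<mu> s) = sets (borel_of (gen_trace_topology I))"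
      "sets \<mu>' = sets (borel_of (gen_trace_topology I))"
    and cones: "\<And>x. x \<in> M \<Longrightarrow> ((\<lambda>s. measure (\<mu> s) (prefix_cone x)) \<longlongrightarrow> measure \<mu>' (prefix_cone x)) F"
  shows "weak_limit (gen_trace_topology I) \<mu> \<mu>' F"
  unfolding weak_limit_def
proof (intro allI impI, elim conjE)
  fix g assume g: "continuous_map (gen_trace_topology I) euclideanreal g"
    "bounded (g ` topspace (gen_trace_topology I))"
  show "((\<lambda>s. integral\<^sup>L (\<mu> s) g) \<longlongrightarrow> integral\<^sup>L \<mu>' g) F"
  proof (rule tendstoI)
    fix e :: real assume "0 < e"
    then obtain n where n: "\<And>\<xi>. \<xi> \<in> gen_traces I \<Longrightarrow> \<bar>g \<xi> - g (trunc n \<xi>)\<bar> \<le> e / 4"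
      using uniform_truncation[OF g(1), of "e / 4"] by auto
    define A where "A N = (\<Sum>\<kappa>\<in>trunc n ` gen_traces I. g \<kappa> * measure N (cylinder n \<kappa>))" for N
    have near: "\<bar>integral\<^sup>L N g - A N\<bar> \<le> e / 4"
      if "prob_space N" "sets N = sets (borel_of (gen_trace_topology I))" for N
      unfolding A_def using that g n by (rule integral_near_cylinder_sum)
    have "((\<lambda>s. A (\<mu> s)) \<longlongrightarrow> A \<mu>') F"
      unfolding A_def
      by (intro tendsto_intros measure_cylinder_tendsto[OF prob sets cones])
    then have "\<forall>\<^sub>F s in F. dist (A (\<mu> s)) (A \<mu>') < e / 4"
      using \<open>0 < e\<close> by (intro tendstoD) simp_all
    with prob(1) show "\<forall>\<^sub>F s in F. dist (integral\<^sup>L (\<mu> s) g) (integral\<^sup>L \<mu>' g) < e"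
    proof eventually_elim
      case (elim s)
      then show ?case
        using near[OF elim(1) sets(1)] near[OF prob(2) sets(2)]
        unfolding dist_real_def by linarith
    qed
  qed
qed

end

section \<open>The discrete measures and their limit\<close>

context markov_system begin

abbreviation boltzmann :: "'s \<Rightarrow> real \<Rightarrow> (nat \<Rightarrow> 'a set) measure" where
  "boltzmann \<equiv> boltzmann_measure I act val"

lemma sets_boltzmann: "sets (boltzmann \<beta> s) = sets (borel_of (gen_trace_topology I))"
  by (simp add: boltzmann_measure_def)

lemma val_eq_0: "x \<in> M \<Longrightarrow> x \<notin> traces_from I act \<beta> \<Longrightarrow> val \<beta> x = 0"
  using val_pos_iff[of x \<beta>] val_nonneg[of \<beta> x] by (auto simp: traces_from_def)

lemma emeasure_boltzmann:
  assumes s: "0 \<le> s" "s < 1" and E: "E \<in> sets (borel_of (gen_trace_topology I))"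
  shows "emeasure (boltzmann \<beta> s) E =
    ennreal ((\<Sum>\<^sub>\<infinity>x\<in>{x \<in> M. normal_form I x \<in> E}. weight \<beta> s x) / avoiding_series {} \<beta> s)"
proof -
  let ?D = "traces_from I act \<beta>" and ?h = "\<lambda>x. weight \<beta> s x / avoiding_series {} \<beta> s"
  have DM: "?D \<subseteq> M" by (auto simp: traces_from_def)
  have h: "?h x = (1 / avoiding_series {} \<beta> s) * weight \<beta> s x" for x by simp
  have meas: "normal_form I \<in> measurable (point_measure ?D (\<lambda>x. ennreal (?h x)))
      (borel_of (gen_trace_topology I))"
    using DM normal_form_gen by (auto simp: space_borel_of topspace_gen)
  have "emeasure (boltzmann \<beta> s) E
      = emeasure (point_measure ?D (\<lambda>x. ennreal (?h x))) {x \<in> ?D. normal_form I x \<in> E}"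
    unfolding boltzmann_measure_def gen_series_eq
    by (subst emeasure_distr[OF meas E]) (auto intro!: arg_cong[of _ _ "emeasure _"] simp: space_point_measure)
  also have "\<dots> = ennreal (\<Sum>\<^sub>\<infinity>x\<in>{x \<in> ?D. normal_form I x \<in> E}. ?h x)"
  proof (rule emeasure_point_measure_infsum)
    show "?h summable_on ?D"
      unfolding h using summable_weight[OF s DM] by (intro summable_on_cmult_right)
    show "0 \<le> ?h x" for x using s by (intro divide_nonneg_nonneg weight_nonneg avoiding_series_nonneg)
  qed auto
  also have "(\<Sum>\<^sub>\<infinity>x\<in>{x \<in> ?D. normal_form I x \<in> E}. ?h x)
      = (\<Sum>\<^sub>\<infinity>x\<in>{x \<in> ?D. normal_form I x \<in> E}. weight \<beta> s x) / avoiding_series {} \<beta> s"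
    unfolding h infsum_cmult_right' by simp
  also have "(\<Sum>\<^sub>\<infinity>x\<in>{x \<in> ?D. normal_form I x \<in> E}. weight \<beta> s x)
      = (\<Sum>\<^sub>\<infinity>x\<in>{x \<in> M. normal_form I x \<in> E}. weight \<beta> s x)"
    by (rule infsum_cong_neutral) (use DM val_eq_0 in auto)
  finally show ?thesis .
qed

lemma prob_space_boltzmann:
  assumes s: "0 \<le> s" "s < 1"
  shows "prob_space (boltzmann \<beta> s)"
proof (rule prob_spaceI)
  have "space (boltzmann \<beta> s) = gen_traces I"
    using sets_eq_imp_space_eq[OF sets_boltzmann] by (simp add: space_borel_of topspace_gen)
  moreover have "gen_traces I \<in> sets (borel_of (gen_trace_topology I))"
    by (metis sets.top space_borel_of topspace_gen)
  moreover have "{x \<in> M. normal_form I x \<in> gen_traces I} = M" using normal_form_gen by auto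
  moreover have "(\<Sum>\<^sub>\<infinity>x\<in>M. weight \<beta> s x) = avoiding_series {} \<beta> s" by (simp add: avoiding_series_def)
  ultimately show "emeasure (boltzmann \<beta> s) (space (boltzmann \<beta> s)) = 1"
    using emeasure_boltzmann[OF s] avoiding_series_empty_ge_1[OF s, of \<beta>] by simp
qed

lemma measure_boltzmann_cone:
  assumes s: "0 \<le> s" "s < 1" and x: "x \<in> M"
  shows "measure (boltzmann \<beta> s) (prefix_cone x) =
    weight \<beta> s x * opt_val (\<lambda>\<gamma>. avoiding_series {} \<gamma> s) (act (Some \<beta>) x) / avoiding_series {} \<beta> s"
proof -
  obtain u where u: "x = trace_class I u" using x by (rule traceE)
  have "normal_form I y \<in> prefix_cone x \<longleftrightarrow> trace_le I x y" if y: "y \<in> M" for y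
  proof -
    obtain v where v: "y = trace_class I v" using y by (rule traceE)
    show ?thesis
      using normal_form_gen[OF y] by (simp add: prefix_cone_def u v trace_le_inf_normal_form trace_le_iff)
  qed
  then have "{y \<in> M. normal_form I y \<in> prefix_cone x} = {y \<in> M. trace_le I x y}" by auto
  then have "emeasure (boltzmann \<beta> s) (prefix_cone x) = ennreal
      (weight \<beta> s x * opt_val (\<lambda>\<gamma>. avoiding_series {} \<gamma> s) (act (Some \<beta>) x) / avoiding_series {} \<beta> s)"
    using emeasure_boltzmann[OF s sets_cone[OF x]] infsum_above[OF x] by simp
  moreover have "0 \<le> weight \<beta> s x * opt_val (\<lambda>\<gamma>. avoiding_series {} \<gamma> s) (act (Some \<beta>) x) / avoiding_series {} \<beta> s"
    using s by (intro divide_nonneg_nonneg mult_nonneg_nonneg weight_nonneg avoiding_series_nonneg)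
      (auto simp: opt_val_def avoiding_series_nonneg split: option.split)
  ultimately show ?thesis by (rule measure_eq_emeasure_eq_ennreal[rotated])
qed

lemma measurable_extend: "(\<lambda>\<omega>. \<omega>) \<in> measurable (\<nu> \<beta>) (borel_of (gen_trace_topology I))"
  unfolding borel_of_def
proof (rule measurable_measure_of)
  show "{U. openin (gen_trace_topology I) U} \<subseteq> Pow (topspace (gen_trace_topology I))"
    by (auto dest: openin_subset)
  show "(\<lambda>\<omega>. \<omega>) \<in> space (\<nu> \<beta>) \<rightarrow> topspace (gen_trace_topology I)"
    using infinite_subset_gen by (auto simp: space_nu topspace_gen)
  show "(\<lambda>\<omega>. \<omega>) -` U \<inter> space (\<nu> \<beta>) \<in> sets (\<nu> \<beta>)" if "U \<in> {U. openin (gen_trace_topology I) U}" for U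
    using that sets_nu_Int by (simp add: space_nu)
qed

lemma measure_extend_cone:
  assumes "x \<in> M"
  shows "measure (extend_measure_gen I (\<nu> \<beta>)) (prefix_cone x) = val \<beta> x"
proof -
  have "(\<lambda>\<omega>. \<omega>) -` prefix_cone x \<inter> space (\<nu> \<beta>) = up I x"
    by (simp add: up_eq prefix_cone_def space_nu)
  then show ?thesis
    unfolding extend_measure_gen_def
    by (simp add: measure_distr[OF measurable_extend sets_cone[OF assms]] valuation_def)
qed

end

context irreducible_markov_system begin

text \<open>
  The chain rule turns the mass of the cone of \<open>x\<close> into \<open>f(x) s\<^sup>|\<^sup>x\<^sup>|\<close> times a quotient of
  generating series, and this quotient tends to \<open>1\<close>.
\<close>
lemma boltzmann_cone_tendsto:
  assumes x: "x \<in> M"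
  shows "((\<lambda>s. measure (boltzmann \<alpha> s) (prefix_cone x)) \<longlongrightarrow> val \<alpha> x) (at_left 1)"
proof -
  have "((\<lambda>s. weight \<alpha> s x * opt_val (\<lambda>\<gamma>. avoiding_series {} \<gamma> s) (act (Some \<alpha>) x) / avoiding_series {} \<alpha> s)
      \<longlongrightarrow> val \<alpha> x) (at_left 1)"
  proof (cases "act (Some \<alpha>) x")
    case None
    then have "val \<alpha> x = 0" using x by (intro val_eq_0) (simp_all add: traces_from_def)
    then show ?thesis by simp
  next
    case (Some \<beta>)
    have "((\<lambda>s. weight \<alpha> s x * (avoiding_series {} \<beta> s / avoiding_series {} \<alpha> s))
        \<longlongrightarrow> val \<alpha> x * 1 ^ trace_length x * 1) (at_left 1)"
      by (intro tendsto_intros avoiding_series_quotient_tendsto)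
    then show ?thesis by (simp add: Some)
  qed
  moreover have "\<forall>\<^sub>F s in at_left 1. measure (boltzmann \<alpha> s) (prefix_cone x) =
      weight \<alpha> s x * opt_val (\<lambda>\<gamma>. avoiding_series {} \<gamma> s) (act (Some \<alpha>) x) / avoiding_series {} \<alpha> s"
    by (rule eventually_mono[OF eventually_unit]) (simp add: measure_boltzmann_cone x)
  ultimately show ?thesis by (simp add: tendsto_cong)
qed

end

theorem corollary4p13:
  fixes I :: "('a::finite \<times> 'a) set"
    and act :: "'s::finite option \<Rightarrow> 'a list set \<Rightarrow> 's option"
    and \<nu> :: "'s \<Rightarrow> (nat \<Rightarrow> 'a set) measure"
    and f :: "'s \<Rightarrow> 'a list set \<Rightarrow> real"
    and \<alpha> :: 's
  assumes "concurrent_system I act"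
    and "irreducible_system I act"
    and "markov_measure I act \<nu>"
    and "f = valuation I \<nu>"
  shows "(\<forall>s\<in>{0..<1}. prob_space (boltzmann_measure I act f \<alpha> s)) \<and>
    weak_limit (gen_trace_topology I) (boltzmann_measure I act f \<alpha>)
      (extend_measure_gen I (\<nu> \<alpha>)) (at_left 1)"
proof -
  interpret irreducible_markov_system I act \<nu>
    using assms by unfold_locales
  have "weak_limit (gen_trace_topology I) (boltzmann \<alpha>) (extend_measure_gen I (\<nu> \<alpha>)) (at_left 1)"
  proof (rule weak_limit_if_cones_converge)
    show "\<forall>\<^sub>F s in at_left 1. prob_space (boltzmann \<alpha> s)"
      by (rule eventually_mono[OF eventually_unit]) (simp add: prob_space_boltzmann)
    show "prob_space (extend_measure_gen I (\<nu> \<alpha>))"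
      unfolding extend_measure_gen_def
      using prob_space_nu measurable_extend by (rule prob_space.prob_space_distr)
    show "sets (extend_measure_gen I (\<nu> \<alpha>)) = sets (borel_of (gen_trace_topology I))"
      by (simp add: extend_measure_gen_def)
  qed (simp_all add: sets_boltzmann measure_extend_cone boltzmann_cone_tendsto)
  then show ?thesis
    using prob_space_boltzmann by (simp add: assms(4))
qed

end
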